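(* Let $f$ be a log-regular transcendental entire function of order less than $\frac12$, and let $g$ be the derivative of $f$ or an integral of $f$ (that is, $g=f'$ or $g'=f$). Then $A_R(g)$ is a spider's web, where $R>0$ is such that $M(r,g)>r$ for $r\ge R$.
   Context: For an entire function $f$ put $M(r,f)=\max_{|z|=r}|f(z)|$ for $r>0$. The order of a transcendental entire function $f$ is $\rho(f)=\limsup_{r\to\infty}\frac{\log\log M(r,f)}{\log r}$. $f^n$ is the $n$th iterate of $f$, and $M^n(R,f)$ is the $n$th iterate of the map $r\mapsto M(r,f)$ applied to $R$. $\mathbb N=\{1,2,\ldots\}$. For a transcendental entire function $f$ and $R>0$ with $M(r,f)>r$ for all $r\ge R$, define $A_R(f)=\{z\in\mathbb C: |f^n(z)|\ge M^n(R,f)\text{ for } n\in\mathbb N\}$. A set $E\subset\mathbb C$ is a spider's web if $E$ is connected and there is a sequence $(G_n)_{n\in\mathbb N}$ of bounded simply connected domains with $G_n\subset G_{n+1}$ and $\partial G_n\subset E$ for all $n\in\mathbb N$, and $\bigcup_{n\in\mathbb N}G_n=\mathbb C$. A transcendental entire function $f$ is log-regular (with constant $c>0$) if $\phi(t)=\log M(e^t,f)$ satisfies $\phi'(t)/\phi(t)\ge (1+c)/t$ for all large $t$; it is log-regular if this holds for some $c>0$. (Since $\phi$ is convex, $\phi'$ exists outside a countable set; at exceptional points $\phi'$ is read as the right derivative.) *)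

theory Defs
  imports "HOL-Complex_Analysis.Complex_Analysis"
    "HOL-Computational_Algebra.Polynomial"
begin

definition transcendental_entire :: "(complex \<Rightarrow> complex) \<Rightarrow> bool" where
  "transcendental_entire f \<longleftrightarrow>
     f holomorphic_on UNIV \<and> \<not> (\<exists>p :: complex poly. \<forall>z. f z = poly p z)"

(* The supremum is a maximum for r > 0 and continuous f, see max_modulus_attained;
   the value for r < 0 (empty sphere) is irrelevant. *)
definition max_modulus :: "real \<Rightarrow> (complex \<Rightarrow> complex) \<Rightarrow> real" where
  "max_modulus r f = (SUP z\<in>sphere 0 r. cmod (f z))"

lemma max_modulus_attained:
  assumes "continuous_on UNIV f" and "0 \<le> r"
  shows "\<exists>z\<in>sphere 0 r. max_modulus r f = cmod (f z) \<and> (\<forall>w\<in>sphere 0 r. cmod (f w) \<le> cmod (f z))"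
proof -
  have ne: "sphere (0::complex) r \<noteq> {}" using assms(2) by simp
  have "continuous_on (sphere 0 r) (\<lambda>z. cmod (f z))"
    using assms(1) by (intro continuous_on_norm) (auto intro: continuous_on_subset)
  then obtain z where z: "z \<in> sphere 0 r" "\<forall>w\<in>sphere 0 r. cmod (f w) \<le> cmod (f z)"
    using continuous_attains_sup[OF compact_sphere ne] by blast
  have "max_modulus r f = cmod (f z)"
    unfolding max_modulus_def using z by (intro cSup_eq_maximum) auto
  with z show ?thesis by blast
qed

definition entire_order :: "(complex \<Rightarrow> complex) \<Rightarrow> ereal" where
  "entire_order f = Limsup at_top (\<lambda>r. ereal (ln (ln (max_modulus r f)) / ln r))"

(* The iterate index starts at 1. *)
definition A_set :: "real \<Rightarrow> (complex \<Rightarrow> complex) \<Rightarrow> complex set" where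
  "A_set R f = {z. \<forall>n\<ge>1. cmod ((f ^^ n) z) \<ge> ((\<lambda>r. max_modulus r f) ^^ n) R}"

definition spiders_web :: "complex set \<Rightarrow> bool" where
  "spiders_web E \<longleftrightarrow> connected E \<and>
     (\<exists>G :: nat \<Rightarrow> complex set.
        (\<forall>n. G n \<noteq> {} \<and> open (G n) \<and> connected (G n) \<and> bounded (G n) \<and> simply_connected (G n)) \<and>
        (\<forall>n. G n \<subseteq> G (Suc n)) \<and> (\<forall>n. frontier (G n) \<subseteq> E) \<and> (\<Union>n. G n) = UNIV)"

definition log_max_modulus :: "(complex \<Rightarrow> complex) \<Rightarrow> real \<Rightarrow> real" where
  "log_max_modulus f t = ln (max_modulus (exp t) f)"

(* D is the right derivative; it exists everywhere because log_max_modulus f is convex,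
   and it is the ordinary derivative wherever the latter exists. *)
definition log_regular_with :: "real \<Rightarrow> (complex \<Rightarrow> complex) \<Rightarrow> bool" where
  "log_regular_with c f \<longleftrightarrow> transcendental_entire f \<and>
     (\<forall>\<^sub>F t in at_top. \<exists>D. (log_max_modulus f has_real_derivative D) (at_right t) \<and>
        D / log_max_modulus f t \<ge> (1 + c) / t)"

definition log_regular :: "(complex \<Rightarrow> complex) \<Rightarrow> bool" where
  "log_regular f \<longleftrightarrow> (\<exists>c>0. log_regular_with c f)"

end

(*
Let M(r) = max |g| on |z| = r. Differentiation and integration change M(r, f) so little that, for
g, log-regularity survives as M(r^k) >= M(r)^(k m) for a suitable k given m, and the order of g is
less than 1/2. The latter yields an m such that for every large r some circle |z| = s with
r <= s <= r^m has |g| >= M(r): otherwise g would be smaller than M(r) somewhere on each of these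
circles, and circular projection of the zeros onto the negative axis (in the disc of radius r^m)
together with the harmonic measure of the slit disc would force M(2r) < (3/2) M(r).
Writing R_n = M^n(R), circles |z| = rho_n with R_n^k <= rho_n <= R_n^(k m) then satisfy
|g| >= rho_(n+1) on |z| = rho_n. A continuum that joins 0 to |z| = rho_L therefore contains, for
each n, a point with |g^n| = rho_(L+n), so the component of 0 in the complement of
{|g^n| >= R_(L+n) for all n} lies in |z| < rho_L. These components are the required domains;
their simple connectivity and the connectedness of A_R(g) follow from the maximum principle.
*)
theory Submission imports Defs begin

section \<open>The maximum modulus\<close>

text \<open>The bound 1/2 on the order enters through one exponent. Seen from |z| = 2 r, the outer
  circle of the slit disc of radius S has harmonic measure of size at most a constant times sqrt(r /
  S), while ln M(S) is at most a constant times S^\<rho>. With S = r^m the product sqrt(r / S)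
  S^\<rho> tends to 0 for a suitable m because \<rho> < 1/2. So large circles are located only up to
  the exponent m, and the growth of g has to compensate for that. The differential inequality that
  defines log-regularity is not transferred to g, since nothing pointwise is known about the
  derivative of ln M(., g). Only its integrated form M(r^k, f) >= M(r, f)^(k^(1 + c)) is carried
  over, through M(r, f) <= M(2 r, g)^2 and its counterpart with f and g exchanged. The free exponent
  k pays for the squares and doublings, because k^c exceeds any given multiple of m. Harmonic
  measure and superharmonic functions appear only as moduli of holomorphic functions: Blaschke
  products for the zeros, Harnack's inequality for the zero-free rest, and an explicit exponential
  as a comparison function.\<close>

lemma cmod_le_max_modulus:
  assumes "continuous_on UNIV f"
  shows "cmod (f z) \<le> max_modulus (cmod z) f"
  using max_modulus_attained[OF assms, of "cmod z"] by force

lemma max_modulus_le: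
  assumes "0 \<le> r" and "\<And>z. cmod z = r \<Longrightarrow> cmod (f z) \<le> B"
  shows "max_modulus r f \<le> B"
proof -
  have "sphere (0::complex) r \<noteq> {}"
    using assms(1) by simp
  then show ?thesis
    unfolding max_modulus_def using assms(2) by (intro cSUP_least) auto
qed

lemma max_modulus_nonneg:
  assumes "continuous_on UNIV f" "0 \<le> r"
  shows "0 \<le> max_modulus r f"
  using max_modulus_attained[OF assms] by force

lemma entire_le_max_modulus:
  assumes "f holomorphic_on UNIV" "cmod z \<le> r"
  shows "cmod (f z) \<le> max_modulus r f"
proof (rule maximum_modulus_frontier[of f "cball 0 r" "max_modulus r f" z])
  have c: "continuous_on UNIV f"
    using assms(1) by (rule holomorphic_on_imp_continuous_on)
  then show "continuous_on (closure (cball 0 r)) f"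
    by (rule continuous_on_subset) auto
  show "cmod (f w) \<le> max_modulus r f" if "w \<in> frontier (cball 0 r)" for w
    using cmod_le_max_modulus[OF c, of w] that by auto
qed (use assms in \<open>auto intro: holomorphic_on_subset\<close>)

lemma max_modulus_mono:
  assumes "f holomorphic_on UNIV" "0 \<le> r" "r \<le> s"
  shows "max_modulus r f \<le> max_modulus s f"
  using assms by (intro max_modulus_le entire_le_max_modulus) auto

text \<open>Strictness matters: read backwards, |f z| >= M(r) forces |z| >= r, so the condition on
  one iterate in the definition of \<open>A_set\<close> implies those on all earlier ones.\<close>

lemma entire_less_max_modulus:
  assumes f: "f holomorphic_on UNIV" and nc: "\<not> f constant_on UNIV" and z: "cmod z < r"
  shows "cmod (f z) < max_modulus r f"
proof (rule ccontr)
  assume "\<not> ?thesis"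
  with entire_le_max_modulus[OF f, of z r] z have eq: "cmod (f z) = max_modulus r f"
    by simp
  have "f constant_on ball 0 r"
  proof (rule maximum_modulus_principle[of f "ball 0 r" "ball 0 r" z])
    show "cmod (f w) \<le> cmod (f z)" if "w \<in> ball 0 r" for w
      using entire_le_max_modulus[OF f, of w r] that eq by simp
  qed (use f z in \<open>auto intro: holomorphic_on_subset\<close>)
  then obtain c where c: "\<And>w. w \<in> ball 0 r \<Longrightarrow> f w = c"
    unfolding constant_on_def by auto
  have "f w = c" for w
  proof (rule analytic_continuation_open[of "ball 0 r" UNIV f "\<lambda>_. c" w])
    show "ball (0::complex) r \<noteq> {}"
      using z by (metis ball_eq_empty less_le_trans norm_ge_zero not_less)
  qed (use c f in auto)
  then show False
    using nc unfolding constant_on_def by auto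
qed

lemma max_modulus_at_top:
  assumes f: "f holomorphic_on UNIV" and nc: "\<not> f constant_on UNIV"
  shows "filterlim (\<lambda>r. max_modulus r f) at_top at_top"
  unfolding filterlim_at_top
proof
  fix B :: real
  have "\<not> bounded (range f)"
    using Liouville_theorem[OF f] nc by blast
  then obtain z where "cmod (f z) > B"
    unfolding bounded_iff by (metis image_iff linorder_not_le)
  then have "B \<le> max_modulus r f" if "r \<ge> cmod z" for r
    using entire_le_max_modulus[OF f that] by simp
  then show "\<forall>\<^sub>F r in at_top. B \<le> max_modulus r f"
    using eventually_at_top_linorder by blast
qed

lemma continuous_on_max_modulus:
  assumes f: "f holomorphic_on UNIV"
  shows "continuous_on {0..} (\<lambda>r. max_modulus r f)"
proof -
  have c: "continuous_on UNIV f"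
    using f by (rule holomorphic_on_imp_continuous_on)
  have "continuous_on {0..b} (\<lambda>r. max_modulus r f)" for b
    unfolding continuous_on_iff
  proof safe
    fix r e :: real assume r: "r \<in> {0..b}" and e: "e > 0"
    have "uniformly_continuous_on (cball 0 b) f"
      by (rule compact_uniformly_continuous) (auto intro: continuous_on_subset[OF c])
    then obtain d where d: "d > 0"
      "\<And>z w. z \<in> cball 0 b \<Longrightarrow> w \<in> cball 0 b \<Longrightarrow> dist w z < d \<Longrightarrow> dist (f w) (f z) < e/2"
      unfolding uniformly_continuous_on_def using e by (meson half_gt_zero)
    have le: "max_modulus u f \<le> max_modulus v f + e/2"
      if uv: "u \<in> {0..b}" "v \<in> {0..b}" "dist u v < d" for u v
    proof (rule max_modulus_le)
      fix z assume z: "cmod z = u"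
      \<comment> \<open>Radial projection to the circle of radius \<open>v\<close> moves
        \<open>z\<close> by exactly |u - v|; the origin may go to any point of that circle.\<close>
      define w where "w = (if z = 0 then complex_of_real v else complex_of_real (v / u) * z)"
      have w: "cmod w = v"
        using uv z by (auto simp: w_def norm_mult norm_divide)
      have "dist z w < d"
      proof (cases "z = 0")
        case True
        then show ?thesis using uv z by (simp add: w_def dist_real_def dist_norm)
      next
        case False
        then have u0: "u > 0" using z by auto
        have "z - w = complex_of_real (1 - v / u) * z"
          using False by (simp add: w_def algebra_simps)
        then have "cmod (z - w) = \<bar>1 - v / u\<bar> * u"
          using z by (simp only: norm_mult norm_of_real)
        also have "\<dots> = \<bar>(1 - v / u) * u\<bar>"
          using u0 by (simp add: abs_mult)
        also have "(1 - v / u) * u = u - v"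
          using u0 by (simp add: field_simps)
        finally show ?thesis using uv by (simp add: dist_real_def dist_norm)
      qed
      then have "dist (f z) (f w) < e/2"
        using d(2)[of w z] uv z w by simp
      moreover have "cmod (f z) \<le> cmod (f w) + dist (f z) (f w)"
        by (metis add.commute dist_norm norm_triangle_sub)
      moreover have "cmod (f w) \<le> max_modulus v f"
        using cmod_le_max_modulus[OF c, of w] w by simp
      ultimately show "cmod (f z) \<le> max_modulus v f + e/2" by linarith
    qed (use uv in auto)
    show "\<exists>d>0. \<forall>x'\<in>{0..b}. dist x' r < d \<longrightarrow> dist (max_modulus x' f) (max_modulus r f) < e"
    proof (intro exI[of _ d] conjI ballI impI)
      fix x assume x: "x \<in> {0..b}" "dist x r < d"
      have "max_modulus x f \<le> max_modulus r f + e/2"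
        using le[of x r] x r by simp
      moreover have "max_modulus r f \<le> max_modulus x f + e/2"
        using le[of r x] x r by (simp add: dist_commute)
      ultimately have "\<bar>max_modulus x f - max_modulus r f\<bar> \<le> e/2"
        by linarith
      then show "dist (max_modulus x f) (max_modulus r f) < e"
        unfolding dist_real_def using e by linarith
    qed (rule d(1))
  qed
  then have *: "continuous_on {0..x + 1} (\<lambda>r. max_modulus r f)" for x
    by blast
  show ?thesis
    unfolding continuous_on_eq_continuous_within
  proof
    fix x :: real assume "x \<in> {0..}"
    then have "continuous (at x within {0..x + 1}) (\<lambda>r. max_modulus r f)"
      using *[of x] by (simp add: continuous_on_eq_continuous_within)
    moreover have "at x within {0..x + 1} = at x within {0..}"
      by (rule at_within_nhd[of _ "{..<x + 1}"]) auto
    ultimately show "continuous (at x within {0..}) (\<lambda>r. max_modulus r f)"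
      by simp
  qed
qed

text \<open>Cauchy's estimate on discs of radius r, where the factor 1 / r is at most 1.\<close>

lemma max_modulus_deriv_le:
  assumes f: "f holomorphic_on UNIV" and r: "r \<ge> 1"
  shows "max_modulus r (deriv f) \<le> max_modulus (2 * r) f"
proof (rule max_modulus_le)
  fix z assume z: "cmod z = r"
  have "cmod ((deriv ^^ 1) f z) \<le> fact 1 * max_modulus (2 * r) f / r ^ 1"
  proof (rule Cauchy_inequality)
    show "continuous_on (cball z r) f"
      using holomorphic_on_imp_continuous_on[OF f] by (rule continuous_on_subset) auto
    fix w assume w: "cmod (z - w) = r"
    have "cmod w \<le> 2 * r"
      using norm_triangle_ineq3[of z w] norm_triangle_sub[of w z] w z by (simp add: norm_minus_commute)
    then show "cmod (f w) \<le> max_modulus (2 * r) f"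
      by (rule entire_le_max_modulus[OF f])
  qed (use f r in \<open>auto intro: holomorphic_on_subset\<close>)
  also have "\<dots> \<le> max_modulus (2 * r) f"
    using r max_modulus_nonneg[OF holomorphic_on_imp_continuous_on[OF f], of "2 * r"]
    by (simp add: pos_divide_le_eq mult_le_cancel_left1)
  finally show "cmod (deriv f z) \<le> max_modulus (2 * r) f" by simp
qed (use r in auto)

lemma max_modulus_le_deriv:
  assumes f: "f holomorphic_on UNIV" and r: "r \<ge> 0"
  shows "max_modulus r f \<le> cmod (f 0) + r * max_modulus r (deriv f)"
proof (rule max_modulus_le[OF r])
  fix z assume z: "cmod z = r"
  have f': "deriv f holomorphic_on UNIV"
    using f by (rule holomorphic_deriv) simp
  have "cmod (f z - f 0) \<le> max_modulus r (deriv f) * cmod (z - 0)"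
  proof (rule field_differentiable_bound[of "cball 0 r" f "deriv f"])
    fix w assume "w \<in> cball (0::complex) r"
    then show "cmod (deriv f w) \<le> max_modulus r (deriv f)"
      by (intro entire_le_max_modulus[OF f']) simp
    show "(f has_field_derivative deriv f w) (at w within cball 0 r)"
      using holomorphic_derivI[OF f, of w] by (auto intro: has_field_derivative_at_within)
  qed (use r z in auto)
  then show "cmod (f z) \<le> cmod (f 0) + r * max_modulus r (deriv f)"
    using norm_triangle_sub[of "f z" "f 0"] z by (simp add: mult.commute)
qed

text \<open>The quotient (f z - f 0) / z is entire, so its maximum modulus does not decrease from r
  to 2 r, whereas the denominator doubles. This lower bound is what the absence of circles with
  large minimum modulus will contradict.\<close>

lemma max_modulus_double_ge:
  assumes f: "f holomorphic_on UNIV" and r: "r > 0"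
  shows "2 * max_modulus r f - 3 * cmod (f 0) \<le> max_modulus (2 * r) f"
proof -
  define H where "H = (\<lambda>z. if z = 0 then deriv f 0 else (f z - f 0) / (z - 0))"
  have H: "H holomorphic_on UNIV"
    unfolding H_def using f by (rule pole_lemma) simp
  have eq: "f z - f 0 = z * H z" for z
    by (simp add: H_def)
  have "max_modulus (2 * r) H \<le> (max_modulus (2 * r) f + cmod (f 0)) / (2 * r)"
  proof (rule max_modulus_le)
    fix z assume z: "cmod z = 2 * r"
    have "2 * r * cmod (H z) = cmod (f z - f 0)"
      by (simp add: eq norm_mult z)
    also have "\<dots> \<le> max_modulus (2 * r) f + cmod (f 0)"
      using norm_triangle_ineq4[of "f z" "f 0"] entire_le_max_modulus[OF f, of z "2 * r"] z by simp
    finally show "cmod (H z) \<le> (max_modulus (2 * r) f + cmod (f 0)) / (2 * r)"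
      using r by (simp add: field_simps)
  qed (use r in auto)
  then have *: "r * max_modulus (2 * r) H \<le> (max_modulus (2 * r) f + cmod (f 0)) / 2"
    using r by (simp add: field_simps)
  have "max_modulus r f \<le> cmod (f 0) + r * max_modulus (2 * r) H"
  proof (rule max_modulus_le)
    fix z assume z: "cmod z = r"
    have "cmod (f z) \<le> cmod (f 0) + r * cmod (H z)"
      using norm_triangle_sub[of "f z" "f 0"] z by (simp add: eq norm_mult)
    also have "\<dots> \<le> cmod (f 0) + r * max_modulus (2 * r) H"
      using r z by (intro add_left_mono mult_left_mono entire_le_max_modulus[OF H]) auto
    finally show "cmod (f z) \<le> cmod (f 0) + r * max_modulus (2 * r) H" .
  qed (use r in auto)
  with * show ?thesis by simp
qed

section \<open>Log-regularity and order\<close>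

text \<open>Only right derivatives are given, so the mean value theorem does not apply. After a
  small slope d > 0 is added, the last point where the function is at least \<open>h a\<close> could
  still be moved to the right, unless it is b.\<close>

lemma right_derivative_nonneg_imp_le:
  fixes h :: "real \<Rightarrow> real"
  assumes ab: "a \<le> b" and cont: "continuous_on {a..b} h"
    and der: "\<And>x. a \<le> x \<Longrightarrow> x < b \<Longrightarrow> \<exists>D\<ge>0. (h has_real_derivative D) (at_right x)"
  shows "h a \<le> h b"
proof (rule field_le_epsilon)
  fix e :: real assume e: "e > 0"
  define d where "d = e / (b - a + 1)"
  have d: "d > 0" using e ab by (simp add: d_def)
  define S where "S = {a..b} \<inter> (\<lambda>x. h x + d * (x - a)) -` {h a..}"
  have "closed S"
    unfolding S_def by (intro continuous_closed_preimage continuous_intros cont)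
  moreover have "S \<subseteq> {a..b}" "a \<in> S"
    using ab by (auto simp: S_def)
  ultimately have "compact S" "S \<noteq> {}"
    using compact_Int_closed[of "{a..b}" S] by (auto simp: Int_absorb1)
  from compact_attains_sup[OF this] obtain x where x: "x \<in> S" "\<And>y. y \<in> S \<Longrightarrow> y \<le> x"
    by blast
  have "x = b"
  proof (rule ccontr)
    assume "x \<noteq> b"
    then have xb: "a \<le> x" "x < b" using x(1) by (auto simp: S_def)
    then obtain D where D: "D \<ge> 0" "(h has_real_derivative D) (at_right x)"
      using der by blast
    then have "((\<lambda>y. (h y - h x) / (y - x)) \<longlongrightarrow> D) (at_right x)"
      by (simp add: has_field_derivative_iff)
    then have "\<forall>\<^sub>F y in at_right x. - d < (h y - h x) / (y - x)"
      by (rule order_tendstoD) (use D d in linarith)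
    moreover have "\<forall>\<^sub>F y in at_right x. y < b"
      using xb(2) by (rule eventually_at_right_real[THEN eventually_mono]) auto
    moreover have "\<forall>\<^sub>F y in at_right x. x < y"
      by (rule eventually_at_right_less)
    ultimately have "\<forall>\<^sub>F y in at_right x. - d < (h y - h x) / (y - x) \<and> y < b \<and> x < y"
      by (simp add: eventually_conj_iff)
    then obtain y where y: "- d < (h y - h x) / (y - x)" "y < b" "x < y"
      using eventually_happens[of _ "at_right x"] by (auto simp: trivial_limit_at_right_real)
    then have "- d * (y - x) \<le> h y - h x"
      by (simp add: pos_less_divide_eq)
    then have "y \<in> S"
      using x(1) y xb by (auto simp: S_def algebra_simps)
    then show False using x(2) y(3) by force
  qed
  then have "h a \<le> h b + d * (b - a)"
    using x(1) by (simp add: S_def)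
  also have "d * (b - a) \<le> e"
    using ab e by (simp add: d_def pos_divide_le_eq algebra_simps)
  finally show "h a \<le> h b + e" by simp
qed

lemma transcendental_entireD:
  assumes "transcendental_entire f"
  shows "f holomorphic_on UNIV" "\<not> f constant_on UNIV"
proof -
  show "f holomorphic_on UNIV"
    using assms by (simp add: transcendental_entire_def)
  show "\<not> f constant_on UNIV"
  proof
    assume "f constant_on UNIV"
    then obtain c where "\<And>z. f z = c" by (auto simp: constant_on_def)
    then have "\<forall>z. f z = poly [:c:] z" by simp
    then show False using assms unfolding transcendental_entire_def by blast
  qed
qed

text \<open>With phi = \<open>log_max_modulus f\<close>, the right derivative of ln phi(t) - (1 + c)
  ln t is phi'/phi - (1 + c)/t, which is nonnegative. In other words, phi(t) / t^(1 + c) is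
  nondecreasing.\<close>

lemma log_regular_monotone:
  assumes "log_regular f"
  obtains c T where "c > 0" "T > 0" "\<And>t. t \<ge> T \<Longrightarrow> log_max_modulus f t > 0"
    "\<And>s t. T \<le> s \<Longrightarrow> s \<le> t \<Longrightarrow> ln (log_max_modulus f s) - (1 + c) * ln s
        \<le> ln (log_max_modulus f t) - (1 + c) * ln t"
proof -
  obtain c where c: "c > 0" and f: "transcendental_entire f"
    and reg: "\<forall>\<^sub>F t in at_top. \<exists>D. (log_max_modulus f has_real_derivative D) (at_right t) \<and>
        D / log_max_modulus f t \<ge> (1 + c) / t"
    using assms unfolding log_regular_def log_regular_with_def by blast
  note hol = transcendental_entireD[OF f]
  have "\<forall>\<^sub>F r in at_top. 2 \<le> max_modulus r f"
    using max_modulus_at_top[OF hol] by (simp add: filterlim_at_top)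
  then have "\<forall>\<^sub>F t in at_top. 2 \<le> max_modulus (exp t) f"
    by (rule eventually_compose_filterlim[OF _ exp_at_top])
  then have "\<forall>\<^sub>F t in at_top. 0 < t \<and> 2 \<le> max_modulus (exp t) f \<and>
      (\<exists>D. (log_max_modulus f has_real_derivative D) (at_right t) \<and>
        D / log_max_modulus f t \<ge> (1 + c) / t)"
    using reg eventually_gt_at_top[of 0] by eventually_elim blast
  then obtain T where T: "\<And>t. t \<ge> T \<Longrightarrow> 0 < t \<and> 2 \<le> max_modulus (exp t) f \<and>
      (\<exists>D. (log_max_modulus f has_real_derivative D) (at_right t) \<and>
        D / log_max_modulus f t \<ge> (1 + c) / t)"
    unfolding eventually_at_top_linorder by blast
  have pos: "log_max_modulus f t > 0" if "t \<ge> T" for t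
  proof -
    have "1 < max_modulus (exp t) f" using T[OF that] by simp
    then show ?thesis by (simp add: log_max_modulus_def)
  qed
  have cont: "continuous_on {T..} (log_max_modulus f)"
    unfolding log_max_modulus_def
  proof (intro continuous_on_ln)
    show "continuous_on {T..} (\<lambda>t. max_modulus (exp t) f)"
      by (rule continuous_on_compose2[OF continuous_on_max_modulus[OF hol(1)]])
        (auto intro!: continuous_intros)
    show "\<forall>t\<in>{T..}. max_modulus (exp t) f \<noteq> 0"
      using T by force
  qed
  show ?thesis
  proof (rule that[OF c, of T])
    show "T > 0" using T[of T] by simp
    fix s t assume st: "T \<le> s" "s \<le> t"
    show "ln (log_max_modulus f s) - (1 + c) * ln s \<le> ln (log_max_modulus f t) - (1 + c) * ln t"
    proof (rule right_derivative_nonneg_imp_le[of s t "\<lambda>x. ln (log_max_modulus f x) - (1 + c) * ln x"])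
      show "continuous_on {s..t} (\<lambda>x. ln (log_max_modulus f x) - (1 + c) * ln x)"
      proof (intro continuous_intros)
        show "continuous_on {s..t} (log_max_modulus f)"
          using cont by (rule continuous_on_subset) (use st in auto)
        show "\<forall>x\<in>{s..t}. log_max_modulus f x \<noteq> 0"
          using pos st by (metis atLeastAtMost_iff less_irrefl order_trans)
        show "\<forall>x\<in>{s..t}. x \<noteq> 0"
          using T[of s] st by force
      qed
      fix x assume x: "s \<le> x" "x < t"
      then have Tx: "T \<le> x" using st by simp
      obtain D where D: "(log_max_modulus f has_real_derivative D) (at_right x)"
        "D / log_max_modulus f x \<ge> (1 + c) / x"
        using T[OF Tx] by blast
      have "((\<lambda>x. ln (log_max_modulus f x) - (1 + c) * ln x) has_real_derivative
          D / log_max_modulus f x - (1 + c) / x) (at_right x)"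
        using D(1) pos[OF Tx] T[OF Tx] by (auto intro!: derivative_eq_intros)
      then show "\<exists>D\<ge>0. ((\<lambda>x. ln (log_max_modulus f x) - (1 + c) * ln x) has_real_derivative D) (at_right x)"
        using D(2) by (meson diff_ge_0_iff_ge)
    qed (use st in auto)
  qed (use pos in auto)
qed

text \<open>The quotient phi(t) / t^(1 + c) is compared at t = ln r and at k t. Apart from
  superpolynomial growth, this gain of k^(1 + c) over k is all that is used of
  log-regularity.\<close>

lemma log_regular_growth:
  assumes "log_regular f"
  obtains c r0 where "c > 0" "\<And>r k. r \<ge> r0 \<Longrightarrow> k \<ge> 1 \<Longrightarrow>
    max_modulus r f powr (k powr (1 + c)) \<le> max_modulus (r powr k) f"
proof -
  obtain c T where c: "c > 0" and T: "T > 0" and pos: "\<And>t. t \<ge> T \<Longrightarrow> log_max_modulus f t > 0"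
    and mono: "\<And>s t. T \<le> s \<Longrightarrow> s \<le> t \<Longrightarrow> ln (log_max_modulus f s) - (1 + c) * ln s
        \<le> ln (log_max_modulus f t) - (1 + c) * ln t"
    using log_regular_monotone[OF assms] by metis
  have nz: "max_modulus (exp t) f \<noteq> 0" if "t \<ge> T" for t
    using pos[OF that] by (auto simp: log_max_modulus_def)
  have f: "f holomorphic_on UNIV"
    using assms transcendental_entireD(1) unfolding log_regular_def log_regular_with_def by blast
  have Mpos: "max_modulus (exp t) f > 0" if "t \<ge> T" for t
    using nz[OF that] max_modulus_nonneg[OF holomorphic_on_imp_continuous_on[OF f], of "exp t"]
    by simp
  show ?thesis
  proof (rule that[OF c, of "exp T"])
    fix r k :: real assume r: "r \<ge> exp T" and k: "k \<ge> 1"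
    have r0: "r > 0" using r by (meson exp_gt_zero less_le_trans)
    define t where "t = ln r"
    have t: "T \<le> t" "r = exp t"
      using r r0 by (simp_all add: t_def ln_ge_iff)
    have tk: "t \<le> k * t"
      using k t T by (simp add: mult_le_cancel_right1)
    have "ln (log_max_modulus f t) - (1 + c) * ln t
        \<le> ln (log_max_modulus f (k * t)) - (1 + c) * ln (k * t)"
      using mono[of t "k * t"] t tk by simp
    also have "ln (k * t) = ln k + ln t"
      using k t T by (simp add: ln_mult)
    finally have "ln (log_max_modulus f t) + (1 + c) * ln k \<le> ln (log_max_modulus f (k * t))"
      by (simp add: algebra_simps)
    moreover have "ln (log_max_modulus f t * k powr (1 + c)) = ln (log_max_modulus f t) + (1 + c) * ln k"
      using pos[OF t(1)] k by (simp add: ln_mult ln_powr)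
    ultimately have "log_max_modulus f t * k powr (1 + c) \<le> log_max_modulus f (k * t)"
      using pos[of t] pos[of "k * t"] t tk k by (smt (verit) ln_le_cancel_iff mult_pos_pos powr_gt_zero)
    then have "exp (log_max_modulus f t * k powr (1 + c)) \<le> exp (log_max_modulus f (k * t))"
      by simp
    moreover have "exp (log_max_modulus f (k * t)) = max_modulus (r powr k) f"
      using Mpos[of "k * t"] t tk by (simp add: log_max_modulus_def powr_def)
    moreover have "exp (log_max_modulus f t * k powr (1 + c)) = max_modulus r f powr (k powr (1 + c))"
      using Mpos[of t] t by (simp add: log_max_modulus_def powr_def mult.commute)
    ultimately show "max_modulus r f powr (k powr (1 + c)) \<le> max_modulus (r powr k) f"
      by simp
  qed
qed

lemma powr_real_at_top:
  fixes c :: real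
  assumes "c > 0"
  shows "filterlim (\<lambda>t. t powr c) at_top at_top"
proof -
  have "filterlim (\<lambda>t::real. exp (c * ln t)) at_top at_top"
    using assms
    by (intro filterlim_compose[OF exp_at_top] filterlim_tendsto_pos_mult_at_top[OF tendsto_const]
        ln_at_top)
  moreover have "\<forall>\<^sub>F t::real in at_top. exp (c * ln t) = t powr c"
    using eventually_gt_at_top[of 0] by eventually_elim (simp add: powr_def)
  ultimately show ?thesis
    using filterlim_cong[OF refl refl] by fast
qed

text \<open>Here phi(t) is at least a constant times t^(1 + c), which outgrows K t. The result
  serves to absorb the polynomial factors lost in differentiation and integration.\<close>

lemma log_regular_superpolynomial:
  assumes "log_regular f"
  shows "\<forall>\<^sub>F r in at_top. r powr K \<le> max_modulus r f"
proof -
  obtain c T where c: "c > 0" and T: "T > 0" and pos: "\<And>t. t \<ge> T \<Longrightarrow> log_max_modulus f t > 0"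
    and mono: "\<And>s t. T \<le> s \<Longrightarrow> s \<le> t \<Longrightarrow> ln (log_max_modulus f s) - (1 + c) * ln s
        \<le> ln (log_max_modulus f t) - (1 + c) * ln t"
    using log_regular_monotone[OF assms] by metis
  have f: "f holomorphic_on UNIV"
    using assms transcendental_entireD(1) unfolding log_regular_def log_regular_with_def by blast
  \<comment> \<open>\<open>exp l\<close> is the value of phi(t) / t^(1 + c) at t = T.\<close>
  define l where "l = ln (log_max_modulus f T) - (1 + c) * ln T"
  have "filterlim (\<lambda>t. exp l * t powr c) at_top at_top"
    using c by (intro filterlim_tendsto_pos_mult_at_top[OF tendsto_const] powr_real_at_top) auto
  then have "\<forall>\<^sub>F t in at_top. K \<le> exp l * t powr c"
    by (simp add: filterlim_at_top)
  then have "\<forall>\<^sub>F t in at_top. K \<le> exp l * t powr c \<and> T \<le> t"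
    using eventually_ge_at_top[of T] by eventually_elim simp
  then have "\<forall>\<^sub>F r in at_top. K \<le> exp l * ln r powr c \<and> T \<le> ln r"
    by (rule eventually_compose_filterlim[OF _ ln_at_top])
  then have "\<forall>\<^sub>F r in at_top. (K \<le> exp l * ln r powr c \<and> T \<le> ln r) \<and> r > 0"
    using eventually_gt_at_top[of 0] by eventually_elim simp
  then show ?thesis
  proof eventually_elim
    case (elim r)
    define t where "t = ln r"
    have t: "T \<le> t" "K \<le> exp l * t powr c" "exp t = r"
      using elim by (simp_all add: t_def)
    have "l \<le> ln (log_max_modulus f t) - (1 + c) * ln t"
      unfolding l_def using mono[of T t] t by simp
    then have "exp (l + (1 + c) * ln t) \<le> exp (ln (log_max_modulus f t))"
      by simp
    then have "exp (l + (1 + c) * ln t) \<le> log_max_modulus f t"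
      using pos[OF t(1)] by simp
    moreover have "exp (l + (1 + c) * ln t) = exp l * t powr c * t"
      using t T by (simp add: exp_add powr_def algebra_simps)
    moreover have "K * t \<le> exp l * t powr c * t"
      using t T by (intro mult_right_mono) auto
    ultimately have "K * t \<le> ln (max_modulus r f)"
      using t by (simp add: log_max_modulus_def)
    moreover have "max_modulus r f > 0"
    proof -
      have "max_modulus r f \<noteq> 0"
        using pos[OF t(1)] t by (auto simp: log_max_modulus_def)
      then show ?thesis
        using max_modulus_nonneg[OF holomorphic_on_imp_continuous_on[OF f], of r] elim by simp
    qed
    ultimately show ?case
      using elim by (simp add: powr_def t_def ln_ge_iff)
  qed
qed

lemma entire_order_less_imp_bound:
  assumes f: "transcendental_entire f" and order: "entire_order f < 1/2"
  obtains \<rho> where "0 < \<rho>" "\<rho> < 1/2" "\<forall>\<^sub>F r in at_top. ln (max_modulus r f) \<le> r powr \<rho>"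
proof -
  \<comment> \<open>The maximum with 0 makes \<rho> positive, so that the exponent 2 / (1 - 2
    \<rho>) used for the circles is at least 2.\<close>
  have "max (entire_order f) 0 < ereal (1/2)"
    using order by (simp add: numeral_eq_ereal one_ereal_def)
  then obtain \<rho> where \<rho>: "max (entire_order f) 0 < ereal \<rho>" "ereal \<rho> < ereal (1/2)"
    using ereal_dense2 by blast
  then have "0 < \<rho>" "\<rho> < 1/2"
    by (simp_all add: zero_ereal_def)
  have "\<forall>\<^sub>F r in at_top. ereal (ln (ln (max_modulus r f)) / ln r) < ereal \<rho>"
    using \<rho>(1) unfolding entire_order_def by (intro Limsup_lessD) simp
  moreover have "\<forall>\<^sub>F r in at_top. 2 \<le> max_modulus r f"
    using max_modulus_at_top[OF transcendental_entireD[OF f]] by (simp add: filterlim_at_top)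
  ultimately have "\<forall>\<^sub>F r in at_top. ln (max_modulus r f) \<le> r powr \<rho>"
    using eventually_gt_at_top[of 1]
  proof eventually_elim
    case (elim r)
    have "ln (max_modulus r f) > 0"
      using elim by (intro ln_gt_zero) auto
    moreover have "ln (ln (max_modulus r f)) \<le> \<rho> * ln r"
      using elim by (simp add: pos_divide_less_eq)
    ultimately show ?case
      using elim by (metis exp_le_cancel_iff exp_ln less_trans powr_def not_less_iff_gr_or_eq zero_less_one)
  qed
  with \<open>0 < \<rho>\<close> \<open>\<rho> < 1/2\<close> show ?thesis using that by blast
qed

section \<open>Minimum modulus of functions of order less than one half\<close>

lemma entire_factor_zero:
  assumes "F holomorphic_on UNIV" "F a = 0"
  obtains G where "G holomorphic_on UNIV" "\<And>z. F z = (z - a) * G z"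
proof
  show "(\<lambda>z. if z = a then deriv F a else (F z - F a) / (z - a)) holomorphic_on UNIV"
    using assms(1) by (rule pole_lemma) simp
qed (use assms(2) in auto)

(* An entire function with n zeros in the unit disc is at most (2/3)^n M(4) at any point of the
   disc where it does not vanish, so a factorization with the largest possible n exists. *)
lemma entire_factor_zeros_unit_disc:
  assumes F: "F holomorphic_on UNIV" and z0: "cmod z0 \<le> 1" "F z0 \<noteq> 0"
  obtains as G where "G holomorphic_on UNIV" "\<forall>a\<in>set as. cmod a < 1"
    "\<And>z. F z = (\<Prod>a\<leftarrow>as. z - a) * G z" "\<And>z. cmod z < 1 \<Longrightarrow> G z \<noteq> 0"
proof -
  define P where "P as G \<longleftrightarrow> G holomorphic_on UNIV \<and> (\<forall>a\<in>set as. cmod a < 1) \<and>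
    (\<forall>z. F z = (\<Prod>a\<leftarrow>as. z - a) * G z)" for as G
  \<comment> \<open>On |z| = 4 each factor |z - a| is at least 3, against at most 2 at
    \<open>z0\<close>; any radius above 3 would give a ratio below 1.\<close>
  define B where "B = max_modulus 4 F"
  have cF: "continuous_on UNIV F"
    using F by (rule holomorphic_on_imp_continuous_on)
  have B: "cmod (F z) \<le> B" if "cmod z = 4" for z
    using max_modulus_attained[OF cF, of 4] that by (auto simp: B_def)
  have low: "cmod (\<Prod>a\<leftarrow>as. z - a) \<ge> 3 ^ length as"
    if "\<forall>a\<in>set as. cmod a < 1" "cmod z = 4" for as z
    using that(1)
  proof (induction as)
    case (Cons a as)
    have "cmod (z - a) \<ge> 3"
      using norm_triangle_ineq2[of z a] that(2) Cons.prems by auto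
    then show ?case
      using Cons by (simp add: norm_mult mult_mono')
  qed auto
  have up: "cmod (\<Prod>a\<leftarrow>as. z0 - a) \<le> 2 ^ length as" if "\<forall>a\<in>set as. cmod a < 1" for as
    using that
  proof (induction as)
    case (Cons a as)
    have "cmod (z0 - a) \<le> 2"
      using norm_triangle_ineq4[of z0 a] z0(1) Cons.prems by auto
    then show ?case
      using Cons by (simp add: norm_mult mult_mono')
  qed auto
  have est: "cmod (F z0) \<le> (2/3) ^ length as * B" if "P as G" for as G
  proof -
    have G: "G holomorphic_on UNIV" and as: "\<forall>a\<in>set as. cmod a < 1"
      and eq: "\<And>z. F z = (\<Prod>a\<leftarrow>as. z - a) * G z"
      using that unfolding P_def by auto
    have "cmod (G z0) \<le> B / 3 ^ length as"
    proof (rule maximum_modulus_frontier[of G "cball 0 4"])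
      show "cmod (G z) \<le> B / 3 ^ length as" if "z \<in> frontier (cball 0 4)" for z
      proof -
        have z: "cmod z = 4" using that by simp
        have "cmod (G z) * 3 ^ length as \<le> cmod (G z) * cmod (\<Prod>a\<leftarrow>as. z - a)"
          by (intro mult_left_mono low[OF as z]) auto
        also have "\<dots> = cmod (F z)"
          by (simp add: eq norm_mult mult.commute)
        also have "\<dots> \<le> B"
          using B[OF z] .
        finally show ?thesis by (simp add: field_simps)
      qed
      show "continuous_on (closure (cball 0 4)) G"
        using holomorphic_on_imp_continuous_on[OF G] by (rule continuous_on_subset) auto
    qed (use z0 G in \<open>auto intro: holomorphic_on_subset\<close>)
    then have "cmod (F z0) \<le> 2 ^ length as * (B / 3 ^ length as)"
      unfolding eq[of z0] norm_mult by (intro mult_mono up[OF as]) auto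
    then show ?thesis by (simp add: power_divide)
  qed
  have "(\<lambda>n. (2/3) ^ n * B) \<longlonglongrightarrow> 0"
    by (intro tendsto_mult_left_zero LIMSEQ_power_zero) simp
  then have "\<forall>\<^sub>F n in sequentially. (2/3) ^ n * B < cmod (F z0)"
    by (rule order_tendstoD(2)) (use z0 in simp)
  then obtain N where N: "\<And>n. n \<ge> N \<Longrightarrow> (2/3) ^ n * B < cmod (F z0)"
    unfolding eventually_sequentially by blast
  have P0: "P [] F"
    using F by (simp add: P_def)
  have bd: "length as \<le> N" if "\<exists>G. P as G" for as
  proof (rule ccontr)
    assume "\<not> length as \<le> N"
    then show False
      using est N[of "length as"] that by force
  qed
  define Q where "Q zs \<longleftrightarrow> (\<exists>G. P zs G)" for zs
  have "\<exists>zs. Q zs \<and> (\<forall>bs. Q bs \<longrightarrow> length bs \<le> length zs)"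
    by (rule ex_has_greatest_nat[of Q "[]" length "Suc N"]) (use P0 bd Q_def in \<open>auto simp: less_Suc_eq_le\<close>)
  then obtain as where as: "Q as" "\<And>bs. Q bs \<Longrightarrow> length bs \<le> length as"
    by blast
  then obtain G where G: "P as G" unfolding Q_def by blast
  have "G z \<noteq> 0" if "cmod z < 1" for z
  proof
    assume "G z = 0"
    then obtain H where H: "H holomorphic_on UNIV" "\<And>w. G w = (w - z) * H w"
      using entire_factor_zero[of G z] G unfolding P_def by blast
    have "P (z # as) H"
      using H G that unfolding P_def by (auto simp: ac_simps)
    then have "length (z # as) \<le> length as"
      using as(2)[of "z # as"] unfolding Q_def by blast
    then show False by simp
  qed
  then show ?thesis
    using that[of G as] G unfolding P_def by blast
qed

section \<open>Blaschke factors and circular projection\<close>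

definition blaschke :: "complex \<Rightarrow> complex \<Rightarrow> complex" where
  "blaschke a z = (z - a) / (1 - cnj a * z)"

lemma blaschke_denominator:
  assumes "cmod a < 1" "cmod z \<le> 1"
  shows "1 - cnj a * z \<noteq> 0"
proof
  assume "1 - cnj a * z = 0"
  then have "cnj a * z = 1" by simp
  then have "cmod a * cmod z = 1"
    by (metis complex_mod_cnj norm_mult norm_one)
  moreover have "cmod a * cmod z \<le> cmod a * 1"
    by (intro mult_left_mono assms) auto
  ultimately show False using assms(1) by linarith
qed

text \<open>For prescribed |a| and |z|, only |1 - cnj a z| depends on the arguments of a and z, and
  the modulus of the Blaschke factor increases with it.\<close>

lemma blaschke_norm_sq:
  assumes "cmod a < 1" "cmod z \<le> 1"
  shows "(cmod (blaschke a z))\<^sup>2 =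
    1 - (1 - (cmod a)\<^sup>2) * (1 - (cmod z)\<^sup>2) / (cmod (1 - cnj a * z))\<^sup>2"
proof -
  have "(cmod (z - a))\<^sup>2 = (cmod (1 - cnj a * z))\<^sup>2 - (1 - (cmod a)\<^sup>2) * (1 - (cmod z)\<^sup>2)"
    unfolding cmod_power2 by (simp add: power2_eq_square algebra_simps)
  moreover have "cmod (1 - cnj a * z) \<noteq> 0"
    using blaschke_denominator[OF assms] by simp
  ultimately show ?thesis
    unfolding blaschke_def norm_divide power_divide by (simp add: diff_divide_distrib)
qed

lemma blaschke_norm_le_1:
  assumes "cmod a < 1" "cmod z \<le> 1"
  shows "cmod (blaschke a z) \<le> 1"
proof -
  have "(cmod a)\<^sup>2 \<le> 1" "(cmod z)\<^sup>2 \<le> 1"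
    using assms by (simp_all add: power_le_one)
  then have "(cmod (blaschke a z))\<^sup>2 \<le> 1"
    unfolding blaschke_norm_sq[OF assms] by simp
  then show ?thesis by (simp add: abs_square_le_1)
qed

lemma blaschke_norm_eq_1:
  assumes "cmod a < 1" "cmod z = 1"
  shows "cmod (blaschke a z) = 1"
proof -
  have "(cmod (blaschke a z))\<^sup>2 = 1"
    using blaschke_norm_sq[of a z] assms by simp
  then show ?thesis by (simp add: abs_square_eq_1)
qed

lemma blaschke_norm_mono:
  assumes "cmod a < 1" "cmod a' = cmod a" "cmod z \<le> 1" "cmod z' = cmod z"
    and "cmod (1 - cnj a' * z') \<le> cmod (1 - cnj a * z)"
  shows "cmod (blaschke a' z') \<le> cmod (blaschke a z)"
proof -
  have "(cmod a)\<^sup>2 \<le> 1" "(cmod z)\<^sup>2 \<le> 1"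
    using assms by (simp_all add: power_le_one)
  moreover have pos: "0 < cmod (1 - cnj a' * z')"
    using blaschke_denominator[of a' z'] assms by simp
  moreover from pos have "0 < cmod (1 - cnj a * z)"
    using assms(5) by linarith
  ultimately have "(cmod (blaschke a' z'))\<^sup>2 \<le> (cmod (blaschke a z))\<^sup>2"
    using assms blaschke_norm_sq[of a z] blaschke_norm_sq[of a' z']
    by (auto intro!: divide_left_mono power_mono mult_nonneg_nonneg mult_pos_pos)
  then show ?thesis
    by (rule power2_le_imp_le) simp
qed

text \<open>|1 - cnj a z| lies between 1 - |a| |z| and 1 + |a| |z|. With the zero moved to -|a|
  these extremes are taken at -|z| and at |z|, so the same rotation of the zero serves both
  bounds.\<close>

lemma blaschke_projection:
  assumes a: "cmod a < 1" and z: "cmod z \<le> 1"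
  shows "cmod (blaschke (- of_real (cmod a)) (- of_real (cmod z))) \<le> cmod (blaschke a z)"
    and "cmod (blaschke a z) \<le> cmod (blaschke (- of_real (cmod a)) (of_real (cmod z)))"
proof -
  have p: "cmod a * cmod z \<le> 1"
    using assms by (intro mult_le_one) auto
  have "cmod (1 - cnj (- of_real (cmod a)) * (- of_real (cmod z))) = 1 - cmod a * cmod z"
  proof -
    have "1 - cnj (- of_real (cmod a)) * (- of_real (cmod z))
        = complex_of_real (1 - cmod a * cmod z)"
      by simp
    then show ?thesis using p by (simp only: norm_of_real)
  qed
  moreover have "1 - cmod a * cmod z \<le> cmod (1 - cnj a * z)"
    using norm_triangle_ineq2[of 1 "cnj a * z"] by (simp add: norm_mult)
  ultimately show "cmod (blaschke (- of_real (cmod a)) (- of_real (cmod z))) \<le> cmod (blaschke a z)"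
    using assms by (intro blaschke_norm_mono) auto
  have "cmod (1 - cnj (- of_real (cmod a)) * (of_real (cmod z))) = 1 + cmod a * cmod z"
  proof -
    have "1 - cnj (- of_real (cmod a)) * (of_real (cmod z))
        = complex_of_real (1 + cmod a * cmod z)"
      by simp
    then show ?thesis by (simp only: norm_of_real) (simp add: abs_of_nonneg)
  qed
  moreover have "cmod (1 - cnj a * z) \<le> 1 + cmod a * cmod z"
    using norm_triangle_ineq4[of 1 "cnj a * z"] by (simp add: norm_mult)
  ultimately show "cmod (blaschke a z) \<le> cmod (blaschke (- of_real (cmod a)) (of_real (cmod z)))"
    using assms by (intro blaschke_norm_mono) auto
qed

lemma norm_prod_list_mono:
  fixes f g :: "'a \<Rightarrow> complex"
  assumes "\<And>x. x \<in> set xs \<Longrightarrow> cmod (f x) \<le> cmod (g x)"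
  shows "cmod (\<Prod>x\<leftarrow>xs. f x) \<le> cmod (\<Prod>x\<leftarrow>xs. g x)"
  using assms by (induction xs) (auto simp: norm_mult mult_mono')

lemma norm_prod_list_eq_1:
  fixes f :: "'a \<Rightarrow> complex"
  assumes "\<And>x. x \<in> set xs \<Longrightarrow> cmod (f x) = 1"
  shows "cmod (\<Prod>x\<leftarrow>xs. f x) = 1"
  using assms by (induction xs) (auto simp: norm_mult)

lemma holomorphic_on_prod_list:
  assumes "\<And>x. x \<in> set xs \<Longrightarrow> f x holomorphic_on S"
  shows "(\<lambda>z. \<Prod>x\<leftarrow>xs. f x z) holomorphic_on S"
  using assms by (induction xs) (auto intro!: holomorphic_intros)

lemma blaschke_holomorphic:
  assumes "cmod a < 1"
  shows "blaschke a holomorphic_on cball 0 1"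
  unfolding blaschke_def
  using blaschke_denominator[OF assms] by (intro holomorphic_intros) auto

text \<open>The factors 1 - cnj a z are put into G. Blaschke factors have modulus 1 on the unit
  circle, so |G| = |F| <= 1 there, and the maximum principle extends the bound to the disc; plain
  division by z - a would not preserve it.\<close>

lemma blaschke_factorization:
  assumes F: "F holomorphic_on UNIV" and z0: "cmod z0 \<le> 1" "F z0 \<noteq> 0"
    and le1: "\<And>z. cmod z = 1 \<Longrightarrow> cmod (F z) \<le> 1"
  obtains as G where "G holomorphic_on ball 0 1" "\<forall>a\<in>set as. cmod a < 1"
    "\<And>z. cmod z < 1 \<Longrightarrow> F z = (\<Prod>a\<leftarrow>as. blaschke a z) * G z"
    "\<And>z. cmod z < 1 \<Longrightarrow> G z \<noteq> 0" "\<And>z. cmod z < 1 \<Longrightarrow> cmod (G z) \<le> 1"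
proof -
  obtain as H where H: "H holomorphic_on UNIV" and as: "\<forall>a\<in>set as. cmod a < 1"
    and FH: "\<And>z. F z = (\<Prod>a\<leftarrow>as. z - a) * H z" and H0: "\<And>z. cmod z < 1 \<Longrightarrow> H z \<noteq> 0"
    using entire_factor_zeros_unit_disc[OF F z0] by metis
  define G where "G z = (\<Prod>a\<leftarrow>as. 1 - cnj a * z) * H z" for z
  have G: "G holomorphic_on UNIV"
    unfolding G_def by (intro holomorphic_intros holomorphic_on_prod_list H)
  have eq: "F z = (\<Prod>a\<leftarrow>as. blaschke a z) * G z" if "cmod z \<le> 1" for z
  proof -
    have "(\<Prod>a\<leftarrow>as. z - a) = (\<Prod>a\<leftarrow>as. blaschke a z) * (\<Prod>a\<leftarrow>as. 1 - cnj a * z)"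
      using as
    proof (induction as)
      case (Cons a as)
      have "z - a = blaschke a z * (1 - cnj a * z)"
        using blaschke_denominator[of a z] Cons.prems that by (simp add: blaschke_def)
      then show ?case
        using Cons by simp
    qed simp
    then show ?thesis
      unfolding FH G_def by simp
  qed
  have "G z \<noteq> 0" if "cmod z < 1" for z
  proof -
    have "1 - cnj a * z \<noteq> 0" if "a \<in> set as" for a
      using blaschke_denominator[of a z] \<open>cmod z < 1\<close> as that by auto
    then show ?thesis
      unfolding G_def using H0[OF that] by (auto simp: prod_list_zero_iff)
  qed
  moreover have "cmod (G z) \<le> 1" if z: "cmod z < 1" for z
  proof (rule maximum_modulus_frontier[of G "cball 0 1"])
    show "cmod (G w) \<le> 1" if "w \<in> frontier (cball 0 1)" for w
    proof -
      have "cmod w = 1" using that by simp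
      moreover from this have "cmod (\<Prod>a\<leftarrow>as. blaschke a w) = 1"
        using as by (intro norm_prod_list_eq_1 blaschke_norm_eq_1) auto
      ultimately show ?thesis
        using eq[of w] le1[of w] by (simp add: norm_mult)
    qed
    show "continuous_on (closure (cball 0 1)) G"
      using holomorphic_on_imp_continuous_on[OF G] by (rule continuous_on_subset) auto
  qed (use z G in \<open>auto intro: holomorphic_on_subset\<close>)
  ultimately show ?thesis
    using that[of G as] eq as holomorphic_on_subset[OF G, of "ball 0 1"] by auto
qed

(* This is Harnack's inequality for the positive harmonic function - ln |G|; the Schwarz lemma is
   applied to a Cayley transform of - ln G. *)
lemma Harnack_zero_free:
  assumes G: "G holomorphic_on ball 0 1" and nz: "\<And>z. cmod z < 1 \<Longrightarrow> G z \<noteq> 0"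
    and le1: "\<And>z. cmod z < 1 \<Longrightarrow> cmod (G z) \<le> 1" and z: "cmod z < 1"
  defines "h \<equiv> - ln (cmod (G 0))"
  shows "exp (- h * ((1 + cmod z) / (1 - cmod z))) \<le> cmod (G z)"
    and "cmod (G z) \<le> exp (- h * ((1 - cmod z) / (1 + cmod z)))"
proof -
  have "(1 - cmod z) * h \<le> (1 + cmod z) * - ln (cmod (G z)) \<and>
        (1 - cmod z) * - ln (cmod (G z)) \<le> (1 + cmod z) * h"
  proof (cases "\<exists>w. cmod w < 1 \<and> cmod (G w) = 1")
    \<comment> \<open>If |G| attains 1, then G is constant and h = 0. Otherwise the real part of -
      ln G is strictly positive, which keeps the denominator of the Cayley transform away from
      0.\<close>
    case True
    then obtain w where w: "cmod w < 1" "cmod (G w) = 1" by blast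
    have "G constant_on ball 0 1"
      by (rule maximum_modulus_principle[OF G, of "ball 0 1" w]) (use w le1 in auto)
    then have "G z = G w" "G 0 = G w"
      using w z unfolding constant_on_def by auto
    then show ?thesis
      using w by (simp add: h_def)
  next
    case False
    then have lt1: "cmod (G w) < 1" if "cmod w < 1" for w
      using le1 that by (meson le_less)
    obtain g where g: "g holomorphic_on ball 0 1" "\<And>w. w \<in> ball 0 1 \<Longrightarrow> exp (g w) = G w"
      using holomorphic_logarithm_exists[of "ball 0 1" G 0] G nz by auto
    define k where "k = (\<lambda>w. - g w)"
    have k: "k holomorphic_on ball 0 1"
      unfolding k_def by (intro holomorphic_intros g)
    have Rek: "Re (k w) = - ln (cmod (G w))" if "cmod w < 1" for w
      using g(2)[of w] that by (metis k_def ln_exp mem_ball_0 norm_exp_eq_Re uminus_complex.sel(1))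
    have pos: "Re (k w) > 0" if "cmod w < 1" for w
      using Rek[OF that] lt1[OF that] nz[OF that] by simp
    have den: "k w + cnj (k 0) \<noteq> 0" if "cmod w < 1" for w
    proof
      assume "k w + cnj (k 0) = 0"
      then have "Re (k w) + Re (k 0) = 0" by (metis cnj.sel(1) plus_complex.sel(1) zero_complex.sel(1))
      then show False using pos[OF that] pos[of 0] by simp
    qed
    define q where "q w = (k w - k 0) / (k w + cnj (k 0))" for w
    have "cmod (q z) \<le> cmod z"
    proof (rule Schwarz_Lemma(1)[of q])
      show "q holomorphic_on ball 0 1"
        unfolding q_def using den by (intro holomorphic_intros k) auto
      show "cmod (q w) < 1" if w: "cmod w < 1" for w
      proof -
        have "(cmod (k w + cnj (k 0)))\<^sup>2 - (cmod (k w - k 0))\<^sup>2 = 4 * Re (k w) * Re (k 0)"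
          unfolding cmod_power2 by (simp add: power2_eq_square algebra_simps)
        also have "\<dots> > 0"
          using pos[OF w] pos[of 0] by simp
        finally have "(cmod (k w - k 0))\<^sup>2 < (cmod (k w + cnj (k 0)))\<^sup>2"
          by simp
        then have "cmod (k w - k 0) < cmod (k w + cnj (k 0))"
          by (rule power2_less_imp_less) simp
        then show ?thesis
          by (simp add: q_def norm_divide divide_less_eq)
      qed
    qed (use z in \<open>auto simp: q_def\<close>)
    then have "cmod (k z - k 0) \<le> cmod z * cmod (k z + cnj (k 0))"
      using den[OF z] by (simp add: q_def norm_divide pos_divide_le_eq)
    then have "(cmod (k z - k 0))\<^sup>2 \<le> (cmod z * cmod (k z + cnj (k 0)))\<^sup>2"
      by (rule power_mono) simp
    then have "(Re (k z) - Re (k 0))\<^sup>2 + (Im (k z) - Im (k 0))\<^sup>2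
        \<le> (cmod z)\<^sup>2 * (Re (k z) + Re (k 0))\<^sup>2 + (cmod z)\<^sup>2 * (Im (k z) - Im (k 0))\<^sup>2"
      unfolding power_mult_distrib cmod_power2 by (simp add: algebra_simps)
    moreover have "(cmod z)\<^sup>2 * (Im (k z) - Im (k 0))\<^sup>2 \<le> 1 * (Im (k z) - Im (k 0))\<^sup>2"
      by (rule mult_right_mono) (use z in \<open>auto simp: abs_square_le_1\<close>)
    ultimately have "(Re (k z) - Re (k 0))\<^sup>2 \<le> (cmod z * (Re (k z) + Re (k 0)))\<^sup>2"
      unfolding power_mult_distrib by linarith
    then have "\<bar>Re (k z) - Re (k 0)\<bar> \<le> cmod z * (Re (k z) + Re (k 0))"
      using pos[OF z] pos[of 0] unfolding abs_le_square_iff[symmetric] abs_mult by simp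
    then show ?thesis
      using Rek[OF z] Rek[of 0] by (auto simp: h_def algebra_simps abs_le_iff)
  qed
  moreover have "1 - cmod z > 0" "1 + cmod z > 0"
    using z by (simp_all add: add_pos_nonneg)
  ultimately have "- h * ((1 + cmod z) / (1 - cmod z)) \<le> ln (cmod (G z))"
    "ln (cmod (G z)) \<le> - h * ((1 - cmod z) / (1 + cmod z))"
    by (auto simp: field_simps)
  then show "exp (- h * ((1 + cmod z) / (1 - cmod z))) \<le> cmod (G z)"
    and "cmod (G z) \<le> exp (- h * ((1 - cmod z) / (1 + cmod z)))"
    using nz[OF z] by (metis exp_le_cancel_iff exp_ln zero_less_norm_iff)+
qed

(* Moving all the mass of the positive superharmonic function - ln |F| to the negative axis. *)
lemma circular_projection:
  assumes F: "F holomorphic_on UNIV" and z0: "cmod z0 \<le> 1" "F z0 \<noteq> 0"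
    and le1: "\<And>z. cmod z = 1 \<Longrightarrow> cmod (F z) \<le> 1"
  obtains Phi where "Phi holomorphic_on ball 0 1" "\<And>z. cmod z < 1 \<Longrightarrow> cmod (Phi z) \<le> 1"
    "\<And>z. cmod z < 1 \<Longrightarrow> cmod (Phi (- of_real (cmod z))) \<le> cmod (F z)"
    "\<And>z. cmod z < 1 \<Longrightarrow> cmod (F z) \<le> cmod (Phi (of_real (cmod z)))"
proof -
  obtain as G where G: "G holomorphic_on ball 0 1" and as: "\<forall>a\<in>set as. cmod a < 1"
    and FG: "\<And>z. cmod z < 1 \<Longrightarrow> F z = (\<Prod>a\<leftarrow>as. blaschke a z) * G z"
    and G0: "\<And>z. cmod z < 1 \<Longrightarrow> G z \<noteq> 0" and G1: "\<And>z. cmod z < 1 \<Longrightarrow> cmod (G z) \<le> 1"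
    using blaschke_factorization[OF F z0 le1] by metis
  define h where "h = - ln (cmod (G 0))"
  have h: "h \<ge> 0"
    using G0[of 0] G1[of 0] by (simp add: h_def)
  define B where "B z = (\<Prod>a\<leftarrow>as. blaschke (- of_real (cmod a)) z)" for z
  \<comment> \<open>- ln |E| is h times the Poisson kernel of the boundary point -1. At -|z| and |z|
    the modulus of E equals the lower and the upper Harnack bound for |G z|.\<close>
  define E where "E z = exp (- of_real h * ((1 - z) / (1 + z)))" for z :: complex
  have den: "1 + z \<noteq> 0" if "cmod z < 1" for z :: complex
    using that by (metis add_eq_0_iff less_irrefl norm_minus_cancel norm_one)
  have E: "cmod (E (of_real x)) = exp (- h * ((1 - x) / (1 + x)))" for x
  proof -
    have "- of_real h * ((1 - of_real x) / (1 + of_real x)) =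
        complex_of_real (- h * ((1 - x) / (1 + x)))"
      by simp
    then show ?thesis
      unfolding E_def norm_exp_eq_Re by (simp only: Re_complex_of_real)
  qed
  show ?thesis
  proof
    have "B holomorphic_on ball 0 1"
      unfolding B_def using as
      by (intro holomorphic_on_prod_list holomorphic_on_subset[OF blaschke_holomorphic]) auto
    moreover have "E holomorphic_on ball 0 1"
      unfolding E_def using den by (intro holomorphic_intros) auto
    ultimately show "(\<lambda>z. B z * E z) holomorphic_on ball 0 1"
      by (rule holomorphic_on_mult)
  next
    fix z :: complex assume z: "cmod z < 1"
    have "cmod (B z) \<le> cmod (\<Prod>a\<leftarrow>as. 1 :: complex)"
      unfolding B_def using as z by (intro norm_prod_list_mono) (auto intro!: blaschke_norm_le_1)
    also have "\<dots> = 1"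
      by (intro norm_prod_list_eq_1) auto
    finally have "cmod (B z) \<le> 1" .
    moreover have "cmod (E z) \<le> 1"
    proof -
      have "Re ((1 - z) / (1 + z)) = (1 - (cmod z)\<^sup>2) / (cmod (1 + z))\<^sup>2"
        unfolding Re_divide cmod_power2 by (simp add: power2_eq_square algebra_simps)
      also have "\<dots> \<ge> 0"
        using z by (simp add: power_le_one)
      finally have "0 \<le> h * Re ((1 - z) / (1 + z))"
        using h by simp
      then have "Re (- of_real h * ((1 - z) / (1 + z))) \<le> 0"
        unfolding times_complex.sel by simp
      then show ?thesis
        unfolding E_def norm_exp_eq_Re by simp
    qed
    ultimately show "cmod (B z * E z) \<le> 1"
      by (simp add: norm_mult mult_le_one)
    have *: "exp (- h * ((1 + cmod z) / (1 - cmod z))) \<le> cmod (G z)"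
      "cmod (G z) \<le> exp (- h * ((1 - cmod z) / (1 + cmod z)))"
      using Harnack_zero_free[OF G G0 G1 z] by (simp_all add: h_def)
    have "cmod (E (- of_real (cmod z))) \<le> cmod (G z)"
      using * E[of "- cmod z"] by simp
    moreover have "cmod (B (- of_real (cmod z))) \<le> cmod (\<Prod>a\<leftarrow>as. blaschke a z)"
      unfolding B_def using as z by (intro norm_prod_list_mono blaschke_projection) auto
    ultimately show "cmod (B (- of_real (cmod z)) * E (- of_real (cmod z))) \<le> cmod (F z)"
      by (simp add: FG[OF z] norm_mult mult_mono')
    have "cmod (G z) \<le> cmod (E (of_real (cmod z)))"
      using * E[of "cmod z"] by simp
    moreover have "cmod (\<Prod>a\<leftarrow>as. blaschke a z) \<le> cmod (B (of_real (cmod z)))"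
      unfolding B_def using as z by (intro norm_prod_list_mono blaschke_projection) auto
    ultimately show "cmod (F z) \<le> cmod (B (of_real (cmod z)) * E (of_real (cmod z)))"
      by (simp add: FG[OF z] norm_mult mult_mono')
  qed
qed

(* With z = w^2 / 2 the disc |z| < 1/2 slit along the negative axis becomes the right half
   of the unit disc, on which Re (2 w - w^2) is at least 1 on the arc and at least 0 on the
   imaginary axis. *)
lemma Milloux_estimate:
  assumes F: "F holomorphic_on UNIV" and le1: "\<And>z. cmod z = 1 \<Longrightarrow> cmod (F z) \<le> 1"
    and \<kappa>: "0 < \<kappa>" "\<kappa> \<le> 1"
    and small: "\<And>s. 0 \<le> s \<Longrightarrow> s \<le> 1/2 \<Longrightarrow> \<exists>z. cmod z = s \<and> cmod (F z) \<le> \<kappa>"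
    and z: "0 < cmod z" "cmod z < 1/2"
  shows "cmod (F z) \<le> \<kappa> * exp (2 * sqrt (2 * cmod z) * ln (1 / \<kappa>))"
proof (cases "F z = 0")
  case True
  then show ?thesis using \<kappa> by simp
next
  case False
  \<comment> \<open>\<open>circular_projection\<close> needs a point where F does not vanish; z
    itself serves.\<close>
  then obtain Phi where Phi: "Phi holomorphic_on ball 0 1"
    and Phi1: "\<And>z. cmod z < 1 \<Longrightarrow> cmod (Phi z) \<le> 1"
    and Phi_low: "\<And>z. cmod z < 1 \<Longrightarrow> cmod (Phi (- of_real (cmod z))) \<le> cmod (F z)"
    and Phi_up: "\<And>z. cmod z < 1 \<Longrightarrow> cmod (F z) \<le> cmod (Phi (of_real (cmod z)))"
    using circular_projection[OF F, of z] le1 z by auto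
  define L where "L = ln (1 / \<kappa>)"
  have L: "L \<ge> 0" "exp (- L) = \<kappa>"
    using \<kappa> by (simp_all add: L_def ln_div)
  define H where "H = {w. Re w > 0} \<inter> ball 0 1"
  define Q where "Q w = Phi (w\<^sup>2 / 2) * exp (- of_real L * (2 * w - w\<^sup>2))" for w
  have H: "closure H \<subseteq> {w. Re w \<ge> 0} \<inter> cball 0 1"
    unfolding H_def by (rule closure_minimal) (auto simp: closed_halfspace_Re_ge intro!: closed_Int)
  have oH: "open H"
    unfolding H_def by (intro open_Int open_halfspace_Re_gt) auto
  \<comment> \<open>Because of the factor 1/2, the closed half-disc is mapped into the open unit
    disc, where Phi is holomorphic; hence Q is continuous up to the boundary.\<close>
  have sq: "cmod (w\<^sup>2 / 2) < 1" if "cmod w \<le> 1" for w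
  proof -
    have "(cmod w)\<^sup>2 \<le> 1" using that by (simp add: power_le_one)
    then show ?thesis by (simp add: norm_divide norm_power)
  qed
  have Q: "Q holomorphic_on cball 0 1"
  proof -
    have "(\<lambda>w. Phi (w\<^sup>2 / 2)) holomorphic_on cball 0 1"
    proof (rule holomorphic_on_compose_gen[of "\<lambda>w. w\<^sup>2 / 2" "cball 0 1" Phi "ball 0 1", unfolded o_def])
      show "(\<lambda>w. w\<^sup>2 / 2) holomorphic_on cball 0 1"
        by (intro holomorphic_intros) auto
      show "(\<lambda>w. w\<^sup>2 / 2) ` cball 0 1 \<subseteq> ball (0 :: complex) 1"
        using sq by auto
    qed (rule Phi)
    then show ?thesis
      unfolding Q_def by (intro holomorphic_intros)
  qed
  have normQ: "cmod (Q w) = cmod (Phi (w\<^sup>2 / 2)) * exp (- L * (2 * Re w - (Re w)\<^sup>2 + (Im w)\<^sup>2))" for w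
    unfolding Q_def norm_mult norm_exp_eq_Re by (simp add: power2_eq_square algebra_simps)
  define w where "w = complex_of_real (sqrt (2 * cmod z))"
  have sqw: "sqrt (2 * cmod z) < 1" "0 < sqrt (2 * cmod z)"
    using z by (simp_all add: real_sqrt_less_iff[of _ 1, simplified])
  then have wH: "w \<in> H"
    by (simp add: H_def w_def)
  have w2: "w\<^sup>2 / 2 = of_real (cmod z)"
    by (simp add: w_def flip: of_real_power)
  have "cmod (Q w) \<le> \<kappa>"
  proof (rule maximum_modulus_frontier[of Q H])
    show "bounded H" unfolding H_def by auto
    show "Q holomorphic_on interior H"
      using Q by (rule holomorphic_on_subset) (use interior_subset H_def in auto)
    show "continuous_on (closure H) Q"
      using holomorphic_on_imp_continuous_on[OF Q] by (rule continuous_on_subset) (use H in auto)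
    fix v assume "v \<in> frontier H"
    then have v: "v \<in> closure H" "v \<notin> H"
      using oH by (auto simp: frontier_def interior_open)
    then have v1: "Re v \<ge> 0" "cmod v \<le> 1"
      using H by auto
    consider "Re v = 0" | "cmod v = 1"
      using v v1 unfolding H_def by fastforce
    then show "cmod (Q v) \<le> \<kappa>"
    proof cases
      case 1
      \<comment> \<open>On the imaginary axis the point v^2 / 2 = -s lies on the slit, where |Phi|
        is at most the smallest modulus of F on |z| = s.\<close>
      define s where "s = (cmod v)\<^sup>2 / 2"
      have s: "0 \<le> s" "s \<le> 1/2"
        using v1 by (simp_all add: s_def power_le_one)
      obtain u where u: "cmod u = s" "cmod (F u) \<le> \<kappa>"
        using small[OF s] by blast
      have "v\<^sup>2 / 2 = - of_real s"
        unfolding s_def cmod_power2 using 1 by (simp add: complex_eq_iff power2_eq_square)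
      then have "cmod (Phi (v\<^sup>2 / 2)) \<le> \<kappa>"
        using Phi_low[of u] u s by simp
      moreover have "exp (- L * (2 * Re v - (Re v)\<^sup>2 + (Im v)\<^sup>2)) \<le> 1"
        using 1 L by simp
      ultimately show ?thesis
        unfolding normQ using mult_mono[of "cmod (Phi (v\<^sup>2 / 2))" \<kappa> _ 1] \<kappa> by simp
    next
      case 2
      have "(Im v)\<^sup>2 = 1 - (Re v)\<^sup>2"
        using 2 cmod_power2[of v] by simp
      moreover have "Re v \<le> 1"
        using 2 complex_Re_le_cmod[of v] by simp
      then have "(Re v)\<^sup>2 \<le> Re v"
        using v1 by (simp add: power2_eq_square mult_left_le)
      ultimately have "2 * Re v - (Re v)\<^sup>2 + (Im v)\<^sup>2 \<ge> 1"
        by simp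
      then have "L * 1 \<le> L * (2 * Re v - (Re v)\<^sup>2 + (Im v)\<^sup>2)"
        by (rule mult_left_mono) (use L in auto)
      then have "exp (- L * (2 * Re v - (Re v)\<^sup>2 + (Im v)\<^sup>2)) \<le> exp (- L)"
        by simp
      then show ?thesis
        unfolding normQ using mult_mono[OF Phi1[OF sq[OF v1(2)]]] L by force
    qed
  qed (rule wH)
  then have "cmod (Phi (of_real (cmod z))) * exp (- L * (2 * Re w - (Re w)\<^sup>2)) \<le> \<kappa>"
    unfolding normQ w2 by (simp add: w_def)
  then have "cmod (Phi (of_real (cmod z))) \<le> \<kappa> * exp (L * (2 * Re w - (Re w)\<^sup>2))"
    by (simp add: exp_minus pos_divide_le_eq flip: divide_inverse)
  also have "\<dots> \<le> \<kappa> * exp (L * (2 * Re w))"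
    using \<kappa> L by (intro mult_left_mono) (auto intro!: mult_left_mono)
  also have "\<dots> = \<kappa> * exp (2 * sqrt (2 * cmod z) * ln (1 / \<kappa>))"
    by (simp add: w_def L_def)
  finally show ?thesis
    using Phi_up[of z] z by simp
qed

section \<open>Circles on which a function of order below one half is large\<close>

lemma order_less_half_min_modulus:
  assumes g: "g holomorphic_on UNIV" and nc: "\<not> g constant_on UNIV"
    and \<rho>: "0 < \<rho>" "\<rho> < 1/2"
    and growth: "\<forall>\<^sub>F r in at_top. ln (max_modulus r g) \<le> A * r powr \<rho>"
  obtains m where "m \<ge> 2" "\<forall>\<^sub>F r in at_top. \<exists>s\<in>{r..r powr m}.
    \<forall>z. cmod z = s \<longrightarrow> max_modulus r g \<le> cmod (g z)"
proof -
  \<comment> \<open>Any m with m (1/2 - \<rho>) > 1/2 would make sqrt(r / S) S^\<rho> tend to 0 for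
    S = r^m; the value 1 on the left turns it into r^(-1/2).\<close>
  define m where "m = 2 / (1 - 2 * \<rho>)"
  have m: "m \<ge> 2" "m * (1/2 - \<rho>) = 1"
    using \<rho> by (simp_all add: m_def field_simps)
  have cg: "continuous_on UNIV g"
    using g by (rule holomorphic_on_imp_continuous_on)
  obtain r1 where r1: "\<And>r. r \<ge> r1 \<Longrightarrow> ln (max_modulus r g) \<le> A * r powr \<rho>"
    using growth unfolding eventually_at_top_linorder by blast
  have "((\<lambda>r. 4 * A * r powr (- (1/2))) \<longlongrightarrow> 0) at_top"
    by (intro tendsto_mult_right_zero tendsto_neg_powr filterlim_ident) auto
  then have "\<forall>\<^sub>F r in at_top. 4 * A * r powr (- (1/2)) < ln (3/2)"
    by (rule order_tendstoD(2)) simp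
  \<comment> \<open>M(r) >= 6 |g 0| turns \<open>max_modulus_double_ge\<close> into M(2 r) >= (3/2)
    M(r); the summand 1 gives ln M(r) >= 0.\<close>
  moreover have "\<forall>\<^sub>F r in at_top. 6 * cmod (g 0) + 1 \<le> max_modulus r g"
    using max_modulus_at_top[OF g nc] by (simp add: filterlim_at_top)
  ultimately have "\<forall>\<^sub>F r in at_top. \<exists>s\<in>{r..r powr m}.
    \<forall>z. cmod z = s \<longrightarrow> max_modulus r g \<le> cmod (g z)"
    using eventually_ge_at_top[of r1] eventually_gt_at_top[of 4]
  proof eventually_elim
    case (elim r)
    show ?case
    proof (rule ccontr)
      assume contra: "\<not> ?thesis"
      define S where "S = r powr m"
      \<comment> \<open>4 r < S places the rescaled point of modulus 2 r / S in the disc of radius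
        1/2 that \<open>Milloux_estimate\<close> requires.\<close>
      have "r powr 2 \<le> S"
        unfolding S_def using m elim by (intro powr_mono) auto
      moreover have "4 * r < r powr 2"
        using elim by (simp add: power2_eq_square)
      ultimately have S: "4 * r < S" by simp
      then have S0: "S > 0" "r > 0" using elim by auto
      define M where "M = (\<lambda>r. max_modulus r g)"
      have mono: "M u \<le> M v" if "0 \<le> u" "u \<le> v" for u v
        unfolding M_def by (rule max_modulus_mono[OF g that])
      have Mr: "1 \<le> M r" "6 * cmod (g 0) \<le> M r"
        using elim norm_ge_zero[of "g 0"] unfolding M_def by linarith+
      have MS: "M r \<le> M S"
        using mono[of r S] S S0 by simp
      define \<kappa> where "\<kappa> = M r / M S"
      have \<kappa>: "0 < \<kappa>" "\<kappa> \<le> 1"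
        using Mr MS by (simp_all add: \<kappa>_def)
      \<comment> \<open>The disc of radius S is rescaled to the unit disc and g is divided by M(S);
        the level M(r) becomes \<kappa>.\<close>
      define F where "F z = g (of_real S * z) / of_real (M S)" for z
      have normF: "cmod (F z) = cmod (g (of_real S * z)) / M S" for z
        using Mr MS by (simp add: F_def norm_divide)
      have "g \<circ> (\<lambda>z. of_real S * z) holomorphic_on UNIV"
        by (rule holomorphic_on_compose) (auto intro!: holomorphic_intros holomorphic_on_subset[OF g])
      then have F: "F holomorphic_on UNIV"
        unfolding F_def o_def using Mr MS by (intro holomorphic_intros) auto
      obtain z0 where z0: "cmod z0 = 2 * r" "M (2 * r) = cmod (g z0)"
        using max_modulus_attained[OF cg, of "2 * r"] S0 by (auto simp: M_def)
      define z where "z = z0 / of_real S"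
      have z: "cmod z = 2 * r / S" "of_real S * z = z0"
        using z0 S0 by (simp_all add: z_def norm_divide)
      have zlt: "0 < cmod z" "cmod z < 1/2"
        unfolding z(1) using S S0 by (simp_all add: field_simps)
      have "cmod (F z) \<le> \<kappa> * exp (2 * sqrt (2 * cmod z) * ln (1 / \<kappa>))"
      proof (rule Milloux_estimate[OF F])
        show "cmod (F w) \<le> 1" if "cmod w = 1" for w
          unfolding normF using Mr MS entire_le_max_modulus[OF g, of "of_real S * w" S] that S0
          by (simp add: norm_mult M_def)
        \<comment> \<open>If S s <= r, the bound M(r) follows from the maximum principle. Otherwise
          S s lies in [r, r^m], and the negated claim supplies a small value.\<close>
        show "\<exists>w. cmod w = s \<and> cmod (F w) \<le> \<kappa>" if s: "0 \<le> s" "s \<le> 1/2" for s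
        proof (cases "S * s \<le> r")
          case True
          have "cmod (g (of_real S * of_real s)) \<le> M r"
            unfolding M_def using True S0 s
            by (intro entire_le_max_modulus[OF g]) (simp add: norm_mult)
          then show ?thesis
            using s Mr MS by (intro exI[of _ "of_real s"]) (simp add: normF \<kappa>_def divide_right_mono)
        next
          case False
          have "S * s \<le> S * 1"
            using s S0 by (intro mult_left_mono) auto
          with False have "S * s \<in> {r..r powr m}"
            by (simp add: S_def)
          with contra obtain w where w: "cmod w = S * s" "cmod (g w) < M r"
            unfolding M_def by (metis linorder_not_le)
          then show ?thesis
            using S0 Mr MS
            by (intro exI[of _ "w / of_real S"]) (simp add: normF \<kappa>_def divide_right_mono norm_divide)
        qed
      qed (use \<kappa> zlt in auto)
      then have "M (2 * r) \<le> M r * exp (2 * sqrt (2 * cmod z) * ln (1 / \<kappa>))"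
      proof -
        define X where "X = exp (2 * sqrt (2 * cmod z) * ln (1 / \<kappa>))"
        assume "cmod (F z) \<le> \<kappa> * exp (2 * sqrt (2 * cmod z) * ln (1 / \<kappa>))"
        then have "M (2 * r) / M S \<le> M r / M S * X"
          by (simp only: normF z(2) z0(2) \<kappa>_def X_def)
        then show "M (2 * r) \<le> M r * X"
          using Mr MS by (simp add: field_simps)
      qed
      also have "2 * sqrt (2 * cmod z) * ln (1 / \<kappa>) = 4 * sqrt (r / S) * (ln (M S) - ln (M r))"
      proof -
        have "sqrt (2 * cmod z) = sqrt (4 * (r / S))"
          by (simp add: z)
        also have "\<dots> = 2 * sqrt (r / S)"
          by (simp only: real_sqrt_mult real_sqrt_four)
        finally show ?thesis
          using Mr MS by (simp add: \<kappa>_def ln_div)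
      qed
      also have "M r * exp (4 * sqrt (r / S) * (ln (M S) - ln (M r))) < M r * (3/2)"
      proof (rule mult_strict_left_mono)
        have "4 * sqrt (r / S) * (ln (M S) - ln (M r)) \<le> 4 * sqrt (r / S) * (A * S powr \<rho>)"
        proof (rule mult_left_mono)
          have "ln (M S) \<le> A * S powr \<rho>"
            using r1[of S] S elim S0 by (simp add: M_def)
          moreover have "0 \<le> ln (M r)" using Mr by simp
          ultimately show "ln (M S) - ln (M r) \<le> A * S powr \<rho>" by linarith
        qed (use S0 in auto)
        also have "\<dots> = 4 * A * (sqrt (r / S) * S powr \<rho>)"
          by simp
        also have "sqrt (r / S) * S powr \<rho> = r powr (- (1/2))"
        proof -
          have "sqrt (r / S) * S powr \<rho> = r powr (1/2) / S powr (1/2) * S powr \<rho>"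
            using S0 by (simp add: powr_half_sqrt real_sqrt_divide)
          also have "\<dots> = r powr (1/2) * S powr (\<rho> - 1/2)"
            by (simp add: powr_diff)
          also have "\<dots> = r powr (1/2 + m * (\<rho> - 1/2))"
            unfolding S_def powr_powr by (simp add: powr_add)
          also have "1/2 + m * (\<rho> - 1/2) = - (1/2)"
            using m(2) by (simp add: algebra_simps)
          finally show ?thesis .
        qed
        also have "4 * A * r powr (- (1/2)) < ln (3/2)"
          using elim by simp
        finally have "exp (4 * sqrt (r / S) * (ln (M S) - ln (M r))) < exp (ln (3/2))"
          by (simp only: exp_less_cancel_iff)
        then show "exp (4 * sqrt (r / S) * (ln (M S) - ln (M r))) < 3/2"
          by simp
      qed (use Mr in auto)
      finally show False
        using max_modulus_double_ge[OF g S0(2)] Mr by (simp add: M_def)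
    qed
  qed
  then show ?thesis using that m by blast
qed

section \<open>Spiders' webs\<close>

text \<open>The sets |h n| >= c n decrease, so compactness yields one index for all of K. The
  infinite intersection is thus replaced by a single holomorphic function, to which the maximum
  principle applies.\<close>

lemma compact_disjoint_super_level_sets:
  fixes h :: "nat \<Rightarrow> complex \<Rightarrow> complex" and c :: "nat \<Rightarrow> real"
  assumes cont: "\<And>n. continuous_on UNIV (h n)"
    and dec: "\<And>n z. c (Suc n) \<le> cmod (h (Suc n) z) \<Longrightarrow> c n \<le> cmod (h n z)"
    and K: "compact K" "K \<inter> {z. \<forall>n. c n \<le> cmod (h n z)} = {}"
  obtains n where "\<And>z. z \<in> K \<Longrightarrow> cmod (h n z) < c n"
proof -
  have mono: "c m \<le> cmod (h m z)" if "m \<le> n" "c n \<le> cmod (h n z)" for m n z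
    using that by (induction rule: dec_induct) (auto dest: dec)
  have op: "open {z. cmod (h n z) < c n}" for n
    by (intro open_Collect_less continuous_intros cont)
  have "K \<subseteq> (\<Union>n\<in>UNIV. {z. cmod (h n z) < c n})"
    using K(2) by (fastforce simp: not_le)
  then obtain C where C: "finite C" "K \<subseteq> (\<Union>n\<in>C. {z. cmod (h n z) < c n})"
    using compactE_image[OF K(1), of UNIV "\<lambda>n. {z. cmod (h n z) < c n}"] op by auto
  show ?thesis
  proof (rule that[of "Max (insert 0 C)"])
    fix z assume "z \<in> K"
    then obtain n where n: "n \<in> C" "cmod (h n z) < c n"
      using C(2) by auto
    have "n \<le> Max (insert 0 C)"
      using n(1) C(1) by simp
    then show "cmod (h (Max (insert 0 C)) z) < c (Max (insert 0 C))"
      using mono[of n "Max (insert 0 C)" z] n(2) by linarith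
  qed
qed

(* A neighbourhood V of B has its frontier outside the set, hence in some |h n| < c n, and the
   maximum principle carries this inequality over to B. *)
lemma super_level_sets_no_compact_part:
  fixes h :: "nat \<Rightarrow> complex \<Rightarrow> complex" and c :: "nat \<Rightarrow> real"
  assumes hol: "\<And>n. h n holomorphic_on UNIV"
    and dec: "\<And>n z. c (Suc n) \<le> cmod (h (Suc n) z) \<Longrightarrow> c n \<le> cmod (h n z)"
    and E: "{z. \<forall>n. c n \<le> cmod (h n z)} \<subseteq> A \<union> B"
    and AB: "closed A" "compact B" "A \<inter> B = {}"
  shows "B \<inter> {z. \<forall>n. c n \<le> cmod (h n z)} = {}"
proof (cases "B = {}")
  case False
  obtain d where d: "d > 0" "\<And>x y. x \<in> A \<Longrightarrow> y \<in> B \<Longrightarrow> d \<le> dist x y"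
    using separate_closed_compact[OF AB] by blast
  define V where "V = {x. infdist x B < d / 2}"
  have "open V"
    unfolding V_def by (intro open_Collect_less continuous_intros)
  have att: "\<exists>b\<in>B. infdist x B = dist x b" for x
    using infdist_attains_inf[of B x] AB(2) False compact_imp_closed by metis
  obtain r where r: "\<And>b. b \<in> B \<Longrightarrow> cmod b \<le> r"
    using compact_imp_bounded[OF AB(2)] unfolding bounded_iff by blast
  have "bounded V"
    unfolding bounded_iff
  proof (intro exI ballI)
    fix x assume "x \<in> V"
    then obtain b where "b \<in> B" "dist x b < d / 2"
      using att[of x] by (auto simp: V_def)
    then show "cmod x \<le> r + d / 2"
      using r[of b] norm_triangle_sub[of x b] by (simp add: dist_norm)
  qed
  have "closure V \<subseteq> {x. infdist x B \<le> d / 2}"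
    by (rule closure_minimal) (auto simp: V_def intro!: closed_Collect_le continuous_intros)
  then have fr: "infdist x B = d / 2" if "x \<in> frontier V" for x
    using that \<open>open V\<close> unfolding frontier_def interior_open[OF \<open>open V\<close>] by (force simp: V_def)
  have "x \<notin> A \<union> B" if "x \<in> frontier V" for x
  proof
    assume "x \<in> A \<union> B"
    moreover have "x \<notin> B" using fr[OF that] d(1) by auto
    moreover have "x \<notin> A" using att[of x] fr[OF that] d by force
    ultimately show False by blast
  qed
  then have dis: "frontier V \<inter> {z. \<forall>n. c n \<le> cmod (h n z)} = {}"
    using E by blast
  have cont: "continuous_on UNIV (h n)" for n
    using hol by (rule holomorphic_on_imp_continuous_on)
  have cpt: "compact (frontier V)"
    using \<open>bounded V\<close> by (rule compact_frontier_bounded)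
  obtain n where n: "\<And>z. z \<in> frontier V \<Longrightarrow> cmod (h n z) < c n"
    by (rule compact_disjoint_super_level_sets[of h c "frontier V", OF cont _ cpt dis]) (use dec in auto)
  \<comment> \<open>The maximum principle is applied with a weak inequality; the constant C < c n,
    found by compactness, preserves strictness.\<close>
  obtain C where C: "C < c n" "\<And>z. z \<in> frontier V \<Longrightarrow> cmod (h n z) \<le> C"
  proof (cases "frontier V = {}")
    case True
    then show ?thesis using that[of "c n - 1"] by simp
  next
    case False
    have "continuous_on (frontier V) (\<lambda>z. cmod (h n z))"
      by (intro continuous_intros continuous_on_subset[OF cont]) auto
    from continuous_attains_sup[OF cpt False this] show ?thesis
      using that n by metis
  qed
  have "cmod (h n b) \<le> C" if "b \<in> B" for b
  proof (rule maximum_modulus_frontier[of "h n" V])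
    show "b \<in> V" using that d(1) by (simp add: V_def)
    show "continuous_on (closure V) (h n)"
      using cont by (rule continuous_on_subset) auto
  qed (use C \<open>bounded V\<close> hol in \<open>auto intro: holomorphic_on_subset\<close>)
  then have "cmod (h n b) < c n" if "b \<in> B" for b
    using C(1) that le_less_trans by blast
  then show ?thesis by (force simp: not_le[symmetric])
qed auto

text \<open>It suffices that the complement of U is connected. A bounded closed piece B split off
  from it contains no point of the level set by \<open>super_level_sets_no_compact_part\<close>,
  hence no frontier point of U. So B is open as well as closed, and being bounded it is
  empty.\<close>

lemma simply_connected_super_level_hole:
  fixes h :: "nat \<Rightarrow> complex \<Rightarrow> complex" and c :: "nat \<Rightarrow> real"
  assumes hol: "\<And>n. h n holomorphic_on UNIV"
    and dec: "\<And>n z. c (Suc n) \<le> cmod (h (Suc n) z) \<Longrightarrow> c n \<le> cmod (h n z)"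
    and U: "open U" "connected U" "bounded U" "U \<inter> {z. \<forall>n. c n \<le> cmod (h n z)} = {}"
    and fr: "frontier U \<subseteq> {z. \<forall>n. c n \<le> cmod (h n z)}"
  shows "simply_connected U"
proof -
  obtain r where r: "U \<subseteq> cball 0 r"
    using bounded_subset_ballD[OF U(3)] ball_subset_cball by blast
  have no: "B = {}"
    if AB: "closed A" "closed B" "A \<union> B = - U" "A \<inter> B = {}" "- cball 0 r \<subseteq> A" for A B
  proof -
    have "bounded B"
      using AB(4,5) by (intro bounded_subset[of "cball 0 r" B]) auto
    then have "compact B"
      using AB(2) by (simp add: compact_eq_bounded_closed)
    moreover have "{z. \<forall>n. c n \<le> cmod (h n z)} \<subseteq> A \<union> B"
      using AB(3) U(4) by blast
    ultimately have "B \<inter> {z. \<forall>n. c n \<le> cmod (h n z)} = {}"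
      using super_level_sets_no_compact_part[of h c A B] hol dec AB by blast
    then have "B \<inter> closure U = {}"
      using fr AB(3) closure_Un_frontier[of U] by blast
    then have "B = - A \<inter> - closure U"
      using AB(3,4) closure_subset[of U] by blast
    then have "open B"
      using AB(1) by (metis closed_closure open_Compl open_Int)
    then have "B = {} \<or> B = UNIV"
      using AB(2) clopen by blast
    then show "B = {}"
      using \<open>bounded B\<close> not_bounded_UNIV by metis
  qed
  have "connected (- U)"
  proof (subst connected_closed_set)
    show "closed (- U)" using U(1) by (rule closed_Compl)
    show "\<nexists>A B. closed A \<and> closed B \<and> A \<noteq> {} \<and> B \<noteq> {} \<and> A \<union> B = - U \<and> A \<inter> B = {}"
    proof
      assume "\<exists>A B. closed A \<and> closed B \<and> A \<noteq> {} \<and> B \<noteq> {} \<and> A \<union> B = - U \<and> A \<inter> B = {}"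
      then obtain A B
        where AB: "closed A" "closed B" "A \<noteq> {}" "B \<noteq> {}" "A \<union> B = - U" "A \<inter> B = {}"
        by blast
      have conn: "connected (- cball (0::complex) r)"
        by (rule connected_complement_bounded_convex) auto
      have sub: "- cball 0 r \<subseteq> A \<union> B"
        using AB(5) r by blast
      have "A \<inter> - cball 0 r = {} \<or> B \<inter> - cball 0 r = {}"
        using connected_closedD[OF conn _ sub AB(1,2)] AB(6) by blast
      then have "- cball 0 r \<subseteq> A \<or> - cball 0 r \<subseteq> B"
        using sub by blast
      then show False
        using no[of A B] no[of B A] AB by (auto simp: Un_commute Int_commute)
    qed
  qed
  then show ?thesis
    using simply_connected_iff_simple[OF U(1,3)] U(2) by blast
qed

text \<open>The frontier of a bounded simply connected G k is connected, so in a separation of the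
  set it lies in one part. The other part then meets the closure of G k in a compact piece that can
  be split off, and such a piece is empty. A large k encloses points of both parts.\<close>

lemma connected_super_level_sets:
  fixes h :: "nat \<Rightarrow> complex \<Rightarrow> complex" and c :: "nat \<Rightarrow> real" and G :: "nat \<Rightarrow> complex set"
  assumes hol: "\<And>n. h n holomorphic_on UNIV"
    and dec: "\<And>n z. c (Suc n) \<le> cmod (h (Suc n) z) \<Longrightarrow> c n \<le> cmod (h n z)"
    and G: "\<And>n. open (G n)" "\<And>n. bounded (G n)" "\<And>n. simply_connected (G n)"
      "\<And>n. G n \<subseteq> G (Suc n)" "(\<Union>n. G n) = UNIV"
      "\<And>n. frontier (G n) \<subseteq> {z. \<forall>n. c n \<le> cmod (h n z)}"
  shows "connected {z. \<forall>n. c n \<le> cmod (h n z)}"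
proof -
  define E where "E = {z. \<forall>n. c n \<le> cmod (h n z)}"
  have cont: "continuous_on UNIV (h n)" for n
    using hol by (rule holomorphic_on_imp_continuous_on)
  have "closed E"
    unfolding E_def by (intro closed_Collect_all closed_Collect_le continuous_intros cont)
  have no: "B \<inter> G n = {}"
    if AB: "closed A" "closed B" "A \<union> B = E" "A \<inter> B = {}" "frontier (G n) \<subseteq> A" for A B n
  proof -
    have "compact (B \<inter> closure (G n))"
      using AB(2) G(2) by (auto simp: compact_eq_bounded_closed)
    moreover have "closed (A \<union> (B - G n))"
      using AB(1,2) G(1) by (intro closed_Un closed_Diff)
    moreover have "(A \<union> (B - G n)) \<inter> (B \<inter> closure (G n)) = {}"
      using AB(4,5) closure_Un_frontier[of "G n"] by blast
    moreover have "E \<subseteq> (A \<union> (B - G n)) \<union> (B \<inter> closure (G n))"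
      using AB(3) closure_subset[of "G n"] by blast
    ultimately have "(B \<inter> closure (G n)) \<inter> E = {}"
      using super_level_sets_no_compact_part[of h c] hol dec unfolding E_def by blast
    then show ?thesis
      using AB(3) closure_subset[of "G n"] by blast
  qed
  have mono: "G m \<subseteq> G n" if "m \<le> n" for m n
    using that G(4) by (rule lift_Suc_mono_le[rotated])
  have "connected E"
    unfolding connected_closed_set[OF \<open>closed E\<close>]
  proof
    assume "\<exists>A B. closed A \<and> closed B \<and> A \<noteq> {} \<and> B \<noteq> {} \<and> A \<union> B = E \<and> A \<inter> B = {}"
    then obtain A B where AB: "closed A" "closed B" "A \<noteq> {}" "B \<noteq> {}" "A \<union> B = E" "A \<inter> B = {}"
      by blast
    obtain a b where ab: "a \<in> A" "b \<in> B" using AB by blast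
    obtain m n where "a \<in> G m" "b \<in> G n"
      using G(5) by (metis UNIV_I UN_E)
    then obtain k where k: "a \<in> G k" "b \<in> G k"
      using mono[of m "max m n"] mono[of n "max m n"] by auto
    have "connected (frontier (G k))"
      using simply_connected_eq_frontier_properties[OF G(1), of k] G(2,3) by simp
    moreover have "frontier (G k) \<subseteq> A \<union> B"
      using G(6) AB(5) unfolding E_def by blast
    ultimately have "A \<inter> frontier (G k) = {} \<or> B \<inter> frontier (G k) = {}"
      using connected_closedD[of "frontier (G k)" A B] AB by blast
    then have "frontier (G k) \<subseteq> A \<or> frontier (G k) \<subseteq> B"
      using \<open>frontier (G k) \<subseteq> A \<union> B\<close> by blast
    then show False
      using no[of A B k] no[of B A k] AB ab k by (auto simp: Un_commute Int_commute)
  qed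
  then show ?thesis by (simp add: E_def)
qed

section \<open>From expanding circles to a spider's web\<close>

lemma spiders_web_criterion:
  fixes f :: "complex \<Rightarrow> complex" and R :: real and \<rho> :: "nat \<Rightarrow> real"
  defines "a \<equiv> \<lambda>n. ((\<lambda>r. max_modulus r f) ^^ n) R"
  assumes f: "f holomorphic_on UNIV" and nc: "\<not> f constant_on UNIV"
    and R: "R > 0" and expand: "\<And>r. r \<ge> R \<Longrightarrow> max_modulus r f > r"
    and \<rho>: "\<And>n. n \<ge> N \<Longrightarrow> a n \<le> \<rho> n"
      "\<And>n z. n \<ge> N \<Longrightarrow> cmod z = \<rho> n \<Longrightarrow> \<rho> (Suc n) \<le> cmod (f z)"
    and lim: "filterlim a at_top sequentially"
  shows "spiders_web (A_set R f)"
proof -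
  have a_Suc: "a (Suc n) = max_modulus (a n) f" for n
    by (simp add: a_def)
  have aR: "a n \<ge> R" for n
  proof (induction n)
    case (Suc n)
    then show ?case using expand[of "a n"] unfolding a_Suc by linarith
  qed (simp add: a_def)
  have "a n \<le> a (Suc n)" for n
    using expand[OF aR[of n]] unfolding a_Suc by simp
  then have a_mono: "a m \<le> a n" if "m \<le> n" for m n
    using that by (rule lift_Suc_mono_le)
  have hol: "(f ^^ n) holomorphic_on UNIV" for n
  proof (induction n)
    case (Suc n)
    have "f \<circ> (f ^^ n) holomorphic_on UNIV"
      by (rule holomorphic_on_compose[OF Suc]) (auto intro: holomorphic_on_subset[OF f])
    then show ?case by (simp add: o_def)
  qed (simp add: id_def)
  have cont: "continuous_on UNIV (f ^^ n)" for n
    using hol by (rule holomorphic_on_imp_continuous_on)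
  have dec: "a n \<le> cmod w" if "a (Suc n) \<le> cmod (f w)" for n w
    using entire_less_max_modulus[OF f nc, of w "a n"] that unfolding a_Suc by linarith
  \<comment> \<open>The sets \<open>E L\<close> decrease in L, so a frontier in \<open>E L\<close>
    also lies in \<open>E 0\<close>; and \<open>E L\<close> avoids the disc of radius
    \<open>a L\<close>, which makes the holes exhaust the plane.\<close>
  define E where "E L = {z. \<forall>n. a (L + n) \<le> cmod ((f ^^ n) z)}" for L
  have decE: "a (L + n) \<le> cmod ((f ^^ n) z)" if "a (L + Suc n) \<le> cmod ((f ^^ Suc n) z)" for L n z
    using dec[of "L + n" "(f ^^ n) z"] that by simp
  \<comment> \<open>\<open>A_set\<close> starts with the first iterate, \<open>E 0\<close> with the
    point itself; the extra condition follows from that on the first iterate.\<close>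
  have A: "A_set R f = E 0"
  proof -
    have "z \<in> E 0" if "z \<in> A_set R f" for z
    proof -
      have *: "a n \<le> cmod ((f ^^ n) z)" if "n \<ge> 1" for n
        using \<open>z \<in> A_set R f\<close> that unfolding A_set_def a_def by simp
      then have "a n \<le> cmod ((f ^^ n) z)" for n
        using decE[of 0 0 z] *[of 1] *[of n] by (cases "n = 0") auto
      then show ?thesis by (simp add: E_def)
    qed
    then show ?thesis
      unfolding A_set_def E_def a_def by auto
  qed
  have E_mono: "E L' \<subseteq> E L" if "L \<le> L'" for L L'
  proof
    fix z assume "z \<in> E L'"
    then have "a (L' + n) \<le> cmod ((f ^^ n) z)" for n
      by (simp add: E_def)
    moreover have "a (L + n) \<le> a (L' + n)" for n
      using that by (intro a_mono) simp
    ultimately show "z \<in> E L"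
      unfolding E_def using order_trans by blast
  qed
  have E_closed: "closed (E L)" for L
    unfolding E_def by (intro closed_Collect_all closed_Collect_le continuous_intros cont)
  define G where "G L = connected_component_set (- E L) 0" for L
  have G_open: "open (G L)" for L
    unfolding G_def using E_closed by (intro open_connected_component) auto
  have G_conn: "connected (G L)" for L
    unfolding G_def by (rule connected_connected_component)
  have G_sub: "G L \<subseteq> - E L" for L
    unfolding G_def by (rule connected_component_subset)
  have G_mono: "G L \<subseteq> G (Suc L)" for L
    unfolding G_def using E_mono[of L "Suc L"] by (intro connected_component_mono) auto
  have G_frontier: "frontier (G L) \<subseteq> E L" for L
    using frontier_of_connected_component_subset[of "- E L" 0] frontier_subset_closed[OF E_closed, of L]
    unfolding G_def frontier_complement by blast
  have ball: "ball 0 (a L) \<subseteq> G L" for L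
  proof -
    have "ball 0 (a L) \<subseteq> - E L"
    proof
      fix z assume "z \<in> ball (0::complex) (a L)"
      then have "\<not> a (L + 0) \<le> cmod ((f ^^ 0) z)" by simp
      then show "z \<in> - E L" unfolding E_def by blast
    qed
    then show ?thesis
      unfolding G_def using R aR[of L] by (intro connected_component_maximal) auto
  qed
  then have G0: "0 \<in> G L" for L
    using R aR[of L] by force
  \<comment> \<open>The orbit of 0 stays within the circles of radius \<rho> n for n >= N. So 0 is
    the low end in the intermediate value argument below, whose high end is the image of a point on
    the preceding circle.\<close>
  have orbit0: "cmod ((f ^^ n) 0) \<le> a n" for n
  proof (induction n)
    case 0
    then show ?case using R by (simp add: a_def)
  next
    case (Suc n)
    then show ?case
      unfolding a_Suc using entire_le_max_modulus[OF f, of "(f ^^ n) 0" "a n"] by simp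
  qed
  have G_disc: "G L \<subseteq> ball 0 (\<rho> L)" if L: "L \<ge> N" for L
  proof
    fix z assume z: "z \<in> G L"
    show "z \<in> ball 0 (\<rho> L)"
    proof (rule ccontr)
      assume "z \<notin> ball 0 (\<rho> L)"
      then have zge: "\<rho> L \<le> cmod z" by simp
      \<comment> \<open>A path supplies a compact connected set from 0 to z; compactness is needed
        to have |f^n| < a (L + n) on it for a single n.\<close>
      have "path_connected (G L)"
        using G_open G_conn by (simp add: connected_open_path_connected)
      then obtain p where p: "path p" "path_image p \<subseteq> G L" "pathstart p = 0" "pathfinish p = z"
        using z G0 unfolding path_connected_def by metis
      define K where "K = path_image p"
      have K: "compact K" "connected K" "0 \<in> K" "z \<in> K" "K \<inter> E L = {}"
        using p G_sub[of L] pathstart_in_path_image[of p] pathfinish_in_path_image[of p]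
        unfolding K_def by (simp_all add: compact_path_image connected_path_image) blast
      obtain n where n: "\<And>w. w \<in> K \<Longrightarrow> cmod ((f ^^ n) w) < a (L + n)"
        by (rule compact_disjoint_super_level_sets[of "\<lambda>n. f ^^ n" "\<lambda>n. a (L + n)" K])
          (use cont decE K in \<open>auto simp: E_def\<close>)
      have reach: "\<exists>w\<in>K. cmod ((f ^^ j) w) = \<rho> (L + j)" for j
      proof -
        have ivt: "\<exists>w\<in>K. cmod ((f ^^ j) w) = \<rho> (L + j)"
          if "u \<in> K" "\<rho> (L + j) \<le> cmod ((f ^^ j) u)" for u j
        proof -
          have conn: "connected ((\<lambda>w. cmod ((f ^^ j) w)) ` K)"
            by (intro connected_continuous_image K continuous_intros continuous_on_subset[OF cont]) auto
          have "cmod ((f ^^ j) 0) \<le> \<rho> (L + j)"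
            using orbit0[of j] a_mono[of j "L + j"] \<rho>(1)[of "L + j"] L by simp
          from connectedD_interval[OF conn _ _ this that(2)]
          have "\<rho> (L + j) \<in> (\<lambda>w. cmod ((f ^^ j) w)) ` K"
            using that(1) K(3) by blast
          then show ?thesis by auto
        qed
        show ?thesis
        proof (induction j)
          case 0
          show ?case using ivt[of z 0] K(4) zge by simp
        next
          case (Suc j)
          then obtain w where w: "w \<in> K" "cmod ((f ^^ j) w) = \<rho> (L + j)" by blast
          then have "\<rho> (L + Suc j) \<le> cmod ((f ^^ Suc j) w)"
            using \<rho>(2)[of "L + j" "(f ^^ j) w"] L by simp
          then show ?case using ivt[of w "Suc j"] w(1) by simp
        qed
      qed
      then obtain w where "w \<in> K" "cmod ((f ^^ n) w) = \<rho> (L + n)" by blast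
      then show False
        using n[of w] \<rho>(1)[of "L + n"] L by simp
    qed
  qed
  have G_bounded: "bounded (G L)" if "L \<ge> N" for L
    using G_disc[OF that] bounded_ball bounded_subset by blast
  have G_sc: "simply_connected (G L)" if "L \<ge> N" for L
    by (rule simply_connected_super_level_hole[of "\<lambda>n. f ^^ n" "\<lambda>n. a (L + n)"])
      (use hol decE G_open G_conn G_bounded[OF that] G_sub[of L] G_frontier[of L] in
        \<open>auto simp: E_def\<close>)
  have G_Union: "(\<Union>n. G (N + n)) = UNIV"
  proof -
    have "z \<in> (\<Union>n. G (N + n))" for z
    proof -
      have "\<forall>\<^sub>F n in sequentially. cmod z < a n \<and> n \<ge> N"
        using lim eventually_ge_at_top[of N] unfolding filterlim_at_top_dense
        by (simp add: eventually_conj_iff)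
      then obtain n where n: "cmod z < a n" "n \<ge> N"
        unfolding eventually_sequentially by blast
      then have "z \<in> G (N + (n - N))"
        using ball[of n] by auto
      then show ?thesis by blast
    qed
    then show ?thesis by blast
  qed
  have frE0: "frontier (G (N + n)) \<subseteq> E 0" for n
    using G_frontier[of "N + n"] E_mono[of 0 "N + n"] by blast
  have "connected (E 0)"
    unfolding E_def
  proof (rule connected_super_level_sets[of "\<lambda>n. f ^^ n" "\<lambda>n. a (0 + n)" "\<lambda>n. G (N + n)"])
    show "frontier (G (N + n)) \<subseteq> {z. \<forall>n. a (0 + n) \<le> cmod ((f ^^ n) z)}" for n
      using frE0[of n] by (simp add: E_def)
    show "G (N + n) \<subseteq> G (N + Suc n)" for n
      using G_mono[of "N + n"] by simp
    show "a (0 + n) \<le> cmod ((f ^^ n) z)" if "a (0 + Suc n) \<le> cmod ((f ^^ Suc n) z)" for n z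
      using decE[of 0 n z] that by simp
  qed (use hol G_open G_bounded G_sc G_Union in auto)
  moreover have "G (N + n) \<noteq> {}" for n
    using G0 by blast
  ultimately show ?thesis
    unfolding spiders_web_def A
    using G_open G_conn G_bounded G_sc G_mono G_Union frE0
    by (intro conjI exI[of _ "\<lambda>n. G (N + n)"]) auto
qed

text \<open>Otherwise the increasing iterates would converge to a limit l >= R, which by continuity
  would be a fixed point of r |-> M(r).\<close>

lemma max_modulus_iterates_at_top:
  fixes f :: "complex \<Rightarrow> complex" and R :: real
  assumes f: "f holomorphic_on UNIV" and R: "R > 0" and expand: "\<And>r. r \<ge> R \<Longrightarrow> max_modulus r f > r"
  shows "filterlim (\<lambda>n. ((\<lambda>r. max_modulus r f) ^^ n) R) at_top sequentially"
proof -
  define a where "a = (\<lambda>n. ((\<lambda>r. max_modulus r f) ^^ n) R)"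
  have a_Suc: "a (Suc n) = max_modulus (a n) f" for n
    by (simp add: a_def)
  have aR: "a n \<ge> R" for n
  proof (induction n)
    case (Suc n)
    then show ?case using expand[of "a n"] unfolding a_Suc by linarith
  qed (simp add: a_def)
  have "a n \<le> a (Suc n)" for n
    using expand[OF aR[of n]] unfolding a_Suc by simp
  then have inc: "incseq a" by (rule incseq_SucI)
  have "\<exists>n. B \<le> a n" for B
  proof (rule ccontr)
    assume "\<nexists>n. B \<le> a n"
    then have "\<forall>n. a n \<le> B" by (meson linorder_le_cases)
    with incseq_convergent[OF inc] obtain l where l: "a \<longlonglongrightarrow> l" "\<forall>i. a i \<le> l" by metis
    have lR: "R \<le> l" using aR l(2) order_trans by blast
    have "continuous_on {0<..} (\<lambda>r. max_modulus r f)"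
      using continuous_on_max_modulus[OF f] by (rule continuous_on_subset) auto
    then have "isCont (\<lambda>r. max_modulus r f) l"
      using lR R by (intro continuous_on_interior[of "{0<..}"]) (auto simp: interior_open)
    then have "(\<lambda>n. max_modulus (a n) f) \<longlonglongrightarrow> max_modulus l f"
      using l(1) by (rule isCont_tendsto_compose)
    then have "(\<lambda>n. a (Suc n)) \<longlonglongrightarrow> max_modulus l f"
      by (simp add: a_Suc)
    moreover have "(\<lambda>n. a (Suc n)) \<longlonglongrightarrow> l"
      using l(1) by (rule LIMSEQ_Suc)
    ultimately have "max_modulus l f = l"
      by (rule LIMSEQ_unique)
    then show False using expand[OF lR] by simp
  qed
  then have "filterlim a at_top sequentially"
    unfolding filterlim_at_top eventually_sequentially
    by (meson inc incseqD order_trans)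
  then show ?thesis by (simp add: a_def)
qed

text \<open>On |z| = \<rho> n the chain is |g z| >= M(a_n^k) >= M(a_n)^(k m) = a_(n+1)^(k m) >=
  \<rho> (n + 1). The exponent m in the growth condition pays for the unknown position of the next
  circle.\<close>

lemma spiders_web_of_growth:
  fixes g :: "complex \<Rightarrow> complex" and R m k :: real
  assumes g: "g holomorphic_on UNIV" and nc: "\<not> g constant_on UNIV"
    and R: "R > 0" and expand: "\<And>r. r \<ge> R \<Longrightarrow> max_modulus r g > r"
    and m: "\<forall>\<^sub>F r in at_top. \<exists>s\<in>{r..r powr m}. \<forall>z. cmod z = s \<longrightarrow> max_modulus r g \<le> cmod (g z)"
    and k: "k \<ge> 1" "\<forall>\<^sub>F r in at_top. max_modulus r g powr (k * m) \<le> max_modulus (r powr k) g"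
  shows "spiders_web (A_set R g)"
proof -
  define a where "a = (\<lambda>n. ((\<lambda>r. max_modulus r g) ^^ n) R)"
  have lim: "filterlim a at_top sequentially"
    unfolding a_def by (rule max_modulus_iterates_at_top[OF g R expand])
  have "filterlim (\<lambda>r::real. r powr k) at_top at_top"
    using k(1) by (intro powr_real_at_top) simp
  from eventually_compose_filterlim[OF m this]
  have "\<forall>\<^sub>F r in at_top. 1 \<le> r \<and> max_modulus r g powr (k * m) \<le> max_modulus (r powr k) g \<and>
      (\<exists>s\<in>{r powr k..(r powr k) powr m}. \<forall>z. cmod z = s \<longrightarrow> max_modulus (r powr k) g \<le> cmod (g z))"
    using k(2) eventually_ge_at_top[of 1] by eventually_elim blast
  from eventually_compose_filterlim[OF this lim]
  obtain N where N: "\<And>n. n \<ge> N \<Longrightarrow> 1 \<le> a n \<and> max_modulus (a n) g powr (k * m) \<le> max_modulus (a n powr k) g \<and>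
      (\<exists>s\<in>{a n powr k..(a n powr k) powr m}. \<forall>z. cmod z = s \<longrightarrow> max_modulus (a n powr k) g \<le> cmod (g z))"
    unfolding eventually_sequentially by blast
  then have "\<forall>n. \<exists>s. n \<ge> N \<longrightarrow> s \<in> {a n powr k..(a n powr k) powr m} \<and>
      (\<forall>z. cmod z = s \<longrightarrow> max_modulus (a n powr k) g \<le> cmod (g z))"
    by blast
  then obtain \<rho> where \<rho>: "\<And>n. n \<ge> N \<Longrightarrow> \<rho> n \<in> {a n powr k..(a n powr k) powr m}"
    "\<And>n z. n \<ge> N \<Longrightarrow> cmod z = \<rho> n \<Longrightarrow> max_modulus (a n powr k) g \<le> cmod (g z)"
    by metis
  show ?thesis
  proof (rule spiders_web_criterion[OF g nc R expand, of N \<rho>])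
    fix n assume n: "n \<ge> N"
    have "a n powr 1 \<le> a n powr k"
      using N[OF n] k(1) by (intro powr_mono) auto
    then show "((\<lambda>r. max_modulus r g) ^^ n) R \<le> \<rho> n"
      using \<rho>(1)[OF n] N[OF n] by (simp add: a_def)
    fix z assume z: "cmod z = \<rho> n"
    have "\<rho> (Suc n) \<le> (a (Suc n) powr k) powr m"
      using \<rho>(1)[of "Suc n"] n by simp
    also have "\<dots> = max_modulus (a n) g powr (k * m)"
      by (simp add: a_def powr_powr)
    also have "\<dots> \<le> max_modulus (a n powr k) g"
      using N[OF n] by blast
    also have "\<dots> \<le> cmod (g z)"
      using \<rho>(2)[OF n z] .
    finally show "\<rho> (Suc n) \<le> cmod (g z)" .
  qed (use lim in \<open>auto simp: a_def\<close>)
qed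

section \<open>Derivatives and integrals of log-regular functions\<close>

text \<open>C + r x <= x^2 as soon as x >= C + r, so only this lower bound is needed for both
  maximum moduli at 2 r. For g it follows from M(r, f) >= r^3: after C is subtracted and one power
  of r is lost to the division, at least C + r remains for r >= 2 C + 2.\<close>

lemma max_modulus_comparison_log_regular:
  assumes f: "transcendental_entire f" and reg: "log_regular f" and g: "g holomorphic_on UNIV"
    and fg: "\<And>r. r \<ge> 1 \<Longrightarrow> max_modulus r f \<le> C + r * max_modulus (2 * r) g"
      "\<And>r. r \<ge> 1 \<Longrightarrow> max_modulus r g \<le> C + r * max_modulus (2 * r) f"
    and C: "C \<ge> 0"
  shows "\<forall>\<^sub>F r in at_top. r \<le> max_modulus (2 * r) g \<and>
    max_modulus r f \<le> (max_modulus (2 * r) g)\<^sup>2 \<and> max_modulus r g \<le> (max_modulus (2 * r) f)\<^sup>2"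
  using log_regular_superpolynomial[OF reg, of 3] eventually_ge_at_top[of "2 * C + 2"]
proof eventually_elim
  case (elim r)
  note hol = transcendental_entireD(1)[OF f]
  have r: "r \<ge> 1" using elim C by simp
  have *: "C + r * x \<le> x\<^sup>2" if "C + r \<le> x" for x
  proof -
    have "C * 1 + r * x \<le> C * x + r * x"
      using that C r by (intro add_right_mono mult_left_mono) auto
    also have "\<dots> = (C + r) * x" by (simp add: algebra_simps)
    also have "\<dots> \<le> x * x"
      using that C r by (intro mult_right_mono) auto
    finally show ?thesis by (simp add: power2_eq_square)
  qed
  have r3: "r * (r * r) \<le> max_modulus r f"
    using elim r by (simp add: power3_eq_cube)
  have le: "C + r * (C + r) \<le> r * (r * r)"
  proof -
    have r2: "1 \<le> r * r" "r \<le> r * r"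
      using r by (simp_all add: mult_ge1_I mult_le_cancel_left1)
    have "C + r * (C + r) = C * 1 + C * r + r * r"
      by (simp add: distrib_left)
    also have "\<dots> \<le> C * (r * r) + C * (r * r) + 2 * (r * r)"
      using C r2 by (intro add_mono mult_left_mono) auto
    also have "\<dots> = (2 * C + 2) * (r * r)"
      by (simp add: distrib_right)
    also have "\<dots> \<le> r * (r * r)"
      using elim r by (intro mult_right_mono) auto
    finally show ?thesis .
  qed
  have "r * (C + r) \<le> r * max_modulus (2 * r) g"
    using le r3 fg(1)[OF r] by linarith
  then have g2: "C + r \<le> max_modulus (2 * r) g"
    using r by simp
  have "1 * r \<le> r * (C + r)"
    using r C by (intro mult_mono) auto
  then have "C + r \<le> r * (r * r)"
    using le by linarith
  also have "\<dots> \<le> max_modulus (2 * r) f"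
    using r3 max_modulus_mono[OF hol, of r "2 * r"] r by simp
  finally have f2: "C + r \<le> max_modulus (2 * r) f" .
  show ?case
    using *[OF f2] *[OF g2] fg[OF r] g2 C by simp
qed

theorem theorem5p2:
  fixes f g :: "complex \<Rightarrow> complex" and R :: real
  assumes "transcendental_entire f" and "log_regular f" and "entire_order f < 1/2"
    and "g = deriv f \<or> (\<forall>z. (g has_field_derivative f z) (at z))"
    and "R > 0" and "\<forall>r\<ge>R. max_modulus r g > r"
  shows "spiders_web (A_set R g)"
proof -
  note f = transcendental_entireD(1)[OF assms(1)]
  have g: "g holomorphic_on UNIV"
    using assms(4)
  proof
    assume "g = deriv f"
    then show ?thesis using holomorphic_deriv[OF f] by simp
  next
    assume "\<forall>z. (g has_field_derivative f z) (at z)"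
    then show ?thesis by (auto simp: holomorphic_on_open)
  qed
  \<comment> \<open>Applied to h = f if g = f', and to h = g if g' = f. Both cases yield the same
    pair of inequalities and are treated together afterwards.\<close>
  have *: "max_modulus r (deriv h) \<le> C + r * max_modulus (2 * r) h"
    "max_modulus r h \<le> C + r * max_modulus (2 * r) (deriv h)"
    if h: "h holomorphic_on UNIV" and r: "r \<ge> 1" and C: "C \<ge> cmod (h 0)" for h r C
  proof -
    have h': "deriv h holomorphic_on UNIV"
      using h by (rule holomorphic_deriv) simp
    have "max_modulus r (deriv h) \<le> max_modulus (2 * r) h"
      by (rule max_modulus_deriv_le[OF h r])
    also have "\<dots> \<le> r * max_modulus (2 * r) h"
      using r max_modulus_nonneg[OF holomorphic_on_imp_continuous_on[OF h], of "2 * r"]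
      by (simp add: mult_le_cancel_right1)
    also have "\<dots> \<le> C + r * max_modulus (2 * r) h"
      using C order_trans[OF norm_ge_zero C] by simp
    finally show "max_modulus r (deriv h) \<le> C + r * max_modulus (2 * r) h" .
    have "max_modulus r h \<le> cmod (h 0) + r * max_modulus r (deriv h)"
      using max_modulus_le_deriv[OF h, of r] r by simp
    also have "\<dots> \<le> C + r * max_modulus (2 * r) (deriv h)"
      using r C by (intro add_mono mult_left_mono max_modulus_mono[OF h']) auto
    finally show "max_modulus r h \<le> C + r * max_modulus (2 * r) (deriv h)" .
  qed
  define C where "C = max (cmod (f 0)) (cmod (g 0))"
  have C: "C \<ge> cmod (f 0)" "C \<ge> cmod (g 0)" "C \<ge> 0"
    by (auto simp: C_def le_max_iff_disj)
  have fg: "max_modulus r f \<le> C + r * max_modulus (2 * r) g \<and>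
      max_modulus r g \<le> C + r * max_modulus (2 * r) f" if "r \<ge> 1" for r
    using assms(4)
  proof
    assume "g = deriv f"
    then show ?thesis using *[OF f that C(1)] by simp
  next
    assume "\<forall>z. (g has_field_derivative f z) (at z)"
    then have "f = deriv g" by (auto intro: DERIV_imp_deriv[symmetric])
    then show ?thesis using *[OF g that C(2)] by simp
  qed
  have comp: "\<forall>\<^sub>F r in at_top. r \<le> max_modulus (2 * r) g \<and>
    max_modulus r f \<le> (max_modulus (2 * r) g)\<^sup>2 \<and> max_modulus r g \<le> (max_modulus (2 * r) f)\<^sup>2"
    by (rule max_modulus_comparison_log_regular[OF assms(1,2) g, of C]) (use fg C in auto)
  have nc: "\<not> g constant_on UNIV"
  proof
    assume "g constant_on UNIV"
    then obtain c where c: "\<And>z. g z = c" by (auto simp: constant_on_def)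
    have "\<forall>\<^sub>F r in at_top. r \<le> max_modulus (2 * r) g \<and> r > max 0 (cmod c)"
      using comp eventually_gt_at_top[of "max 0 (cmod c)"] by eventually_elim blast
    then obtain r where r: "r \<le> max_modulus (2 * r) g" "r > max 0 (cmod c)"
      using eventually_happens'[OF trivial_limit_at_top_linorder] by blast
    have "0 < r"
      by (rule le_less_trans[OF norm_ge_zero[of c]]) (use r(2) in simp)
    then have "max_modulus (2 * r) g \<le> cmod c"
      by (intro max_modulus_le) (simp_all add: c)
    then show False using r by simp
  qed
  have g1: "\<forall>\<^sub>F r in at_top. 1 \<le> max_modulus r g"
    using max_modulus_at_top[OF g nc] by (simp add: filterlim_at_top)
  have f1: "\<forall>\<^sub>F r in at_top. 1 \<le> max_modulus r f"
    using max_modulus_at_top[OF transcendental_entireD[OF assms(1)]] by (simp add: filterlim_at_top)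
  have double: "filterlim (\<lambda>r::real. 2 * r) at_top at_top"
    by (intro filterlim_tendsto_pos_mult_at_top[OF tendsto_const] filterlim_ident) auto

  obtain \<rho> where \<rho>: "0 < \<rho>" "\<rho> < 1/2" "\<forall>\<^sub>F r in at_top. ln (max_modulus r f) \<le> r powr \<rho>"
    using entire_order_less_imp_bound[OF assms(1,3)] .
  have "\<forall>\<^sub>F r in at_top. ln (max_modulus r g) \<le> (2 * 2 powr \<rho>) * r powr \<rho>"
    using comp g1 eventually_compose_filterlim[OF \<rho>(3) double]
      eventually_compose_filterlim[OF f1 double] eventually_gt_at_top[of 0]
  proof eventually_elim
    case (elim r)
    have "ln (max_modulus r g) \<le> ln ((max_modulus (2 * r) f)\<^sup>2)"
      using elim by (subst ln_le_cancel_iff) auto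
    also have "\<dots> = 2 * ln (max_modulus (2 * r) f)"
      using elim by (subst ln_realpow) auto
    also have "\<dots> \<le> 2 * (2 * r) powr \<rho>"
      using elim by simp
    also have "\<dots> = (2 * 2 powr \<rho>) * r powr \<rho>"
      using elim by (simp add: powr_mult)
    finally show ?case .
  qed
  then obtain m where m: "m \<ge> 2" "\<forall>\<^sub>F r in at_top. \<exists>s\<in>{r..r powr m}.
      \<forall>z. cmod z = s \<longrightarrow> max_modulus r g \<le> cmod (g z)"
    using order_less_half_min_modulus[OF g nc \<rho>(1,2)] by blast

  obtain c r0 where c: "c > 0" and growth: "\<And>r k. r \<ge> r0 \<Longrightarrow> k \<ge> 1 \<Longrightarrow>
    max_modulus r f powr (k powr (1 + c)) \<le> max_modulus (r powr k) f"
    by (rule log_regular_growth[OF assms(2)]) blast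
  \<comment> \<open>The choice gives (k / 2)^c >= 8 m, hence p >= 4 k m. One factor 2 pays for M(r,
    g) <= M(2 r, f)^2, the other for the square in M(r^k / 2, f) <= M(r^k, g)^2.\<close>
  define k where "k = max 4 (2 * (8 * m) powr (1 / c))"
  define p where "p = (k / 2) powr (1 + c)"
  have k: "k \<ge> 4" by (simp add: k_def)
  have "8 * m = ((8 * m) powr (1 / c)) powr c"
    using m c by (simp add: powr_powr)
  also have "\<dots> \<le> (k / 2) powr c"
    using c by (intro powr_mono2) (auto simp: k_def)
  finally have "k / 2 * (8 * m) \<le> k / 2 * (k / 2) powr c"
    using k by (intro mult_left_mono) auto
  also have "\<dots> = p"
    using k by (simp add: p_def powr_add)
  finally have p: "4 * (k * m) \<le> p" by simp
  have half: "filterlim (\<lambda>r. r powr k / 2) at_top at_top"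
    using filterlim_tendsto_pos_mult_at_top[OF tendsto_const _ powr_real_at_top, of "1/2" k] k by simp
  have "\<forall>\<^sub>F r in at_top. max_modulus r g powr (k * m) \<le> max_modulus (r powr k) g"
    using comp g1 eventually_compose_filterlim[OF comp half] eventually_compose_filterlim[OF f1 double]
      eventually_ge_at_top[of r0] eventually_ge_at_top[of 4]
  proof eventually_elim
    case (elim r)
    define M where "M = max_modulus r g"
    define F where "F = max_modulus (2 * r) f"
    have M: "1 \<le> M" "M \<le> F\<^sup>2" and F: "1 \<le> F"
      using elim by (simp_all add: M_def F_def)
    \<comment> \<open>Growth of f is used with the exponent k / 2 instead of k; the other half of
      the exponent absorbs the doubling of r and the halving of r^k.\<close>
    have ineq: "(2 * r) powr (k / 2) \<le> r powr k / 2"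
    proof -
      have "2 * 2 powr (k / 2) = (2::real) powr (1 + k / 2)"
        by (simp add: powr_add)
      also have "\<dots> \<le> 2 powr k"
        using k by (intro powr_mono) auto
      also have "(2::real) powr k = 4 powr (k / 2)"
        using powr_powr[of 2 2 "k / 2"] by simp
      also have "\<dots> \<le> r powr (k / 2)"
        using elim k by (intro powr_mono2) auto
      finally have "2 * 2 powr (k / 2) * r powr (k / 2) \<le> r powr (k / 2) * r powr (k / 2)"
        by (intro mult_right_mono) auto
      also have "\<dots> = r powr k"
        by (simp flip: powr_add)
      finally show ?thesis
        using elim by (simp add: powr_mult)
    qed
    have "(M powr (k * m))\<^sup>2 = M powr (2 * (k * m))"
      using M by (simp add: powr_power mult.commute)
    also have "\<dots> \<le> M powr (p / 2)"
      using M p by (intro powr_mono) auto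
    also have "\<dots> \<le> (F\<^sup>2) powr (p / 2)"
      using M by (intro powr_mono2) (auto simp: p_def)
    also have "\<dots> = F powr p"
      using F by (simp add: powr_powr flip: powr_numeral)
    also have "\<dots> \<le> max_modulus ((2 * r) powr (k / 2)) f"
      using growth[of "2 * r" "k / 2"] elim k by (simp add: F_def p_def)
    also have "\<dots> \<le> max_modulus (r powr k / 2) f"
      using ineq by (intro max_modulus_mono[OF f]) auto
    also have "\<dots> \<le> (max_modulus (r powr k) g)\<^sup>2"
      using elim by simp
    finally show ?case
      unfolding M_def
      by (rule power2_le_imp_le)
        (rule max_modulus_nonneg[OF holomorphic_on_imp_continuous_on[OF g]], simp)
  qed
  then show ?thesis
    using spiders_web_of_growth[OF g nc assms(5) _ m(2), of k] assms(6) k by auto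
qed

end
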